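(* Let $D\ge 1$ and $N>2D$ be integers, let $q$ be a prime power, let $\Gamma=J_q(N,D)$, and let $x$ be a vertex of $\Gamma$. Let $W$ be an irreducible $T$-submodule of the nucleus $\mathcal{N}=\mathcal{N}(x)$ with endpoint $r$. Then $W^{\mathcal{H}}$ is an irreducible $\mathcal{H}$-module that is alpha-dominant with gap $r$.
   Context: Let $\mathbb{F}_q$ be a finite field with $q$ elements and $\mathcal{V}$ an $N$-dimensional vector space over $\mathbb{F}_q$. The Grassmann graph $\Gamma=J_q(N,D)$ has vertex set $X$ consisting of the $D$-dimensional subspaces of $\mathcal{V}$; $y,z\in X$ are adjacent iff $\dim(y\cap z)=D-1$. Let $\partial$ be the path-length distance; for $N>2D$ the diameter is $D$ and $\partial(y,z)=D-\dim(y\cap z)$. Put $[\ell]=\frac{q^\ell-1}{q-1}$. Terwilliger algebra and nucleus. Let $A\in\mathrm{Mat}_X(\mathbb{C})$ be the adjacency matrix of $\Gamma$ and $V=\mathbb{C}^X$. $A$ has exactly $D+1$ distinct eigenvalues $\theta_0>\cdots>\theta_D$, namely $\theta_i=q[D][N-D]-[i][N-i+1]$; let $E_i$ be the orthogonal projection of $V$ onto the $\theta_i$-eigenspace. For $0\le i\le D$ let $E_i^*$ be the diagonal matrix with $(y,y)$-entry $1$ if $\partial(x,y)=i$ and $0$ otherwise. $T=T(x)$ is the subalgebra of $\mathrm{Mat}_X(\mathbb{C})$ generated by $A,E_0^*,\dots,E_D^*$. A $T$-module is a subspace $W\subseteq V$ with $TW\subseteq W$; irreducible means nonzero with no $T$-submodule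 other than $0$ and $W$. An irreducible $T$-module $W$ has endpoint $r=\min\{i: E_i^*W\ne0\}$, dual endpoint $t=\min\{i: E_iW\neq 0\}$, diameter $d=|\{i: E_i^*W\ne 0\}|-1$, and displacement $r+t-D+d$. The nucleus $\mathcal{N}$ is the span of all irreducible $T$-modules with displacement $0$. The algebra $\mathcal{H}$. Let $P$ be the set of all subspaces of $\mathcal{V}$. For $0\le i\le D$, $0\le j\le N-D$ let $P_{i,j}=\{u\in P: \dim(u\cap x)=i,\ \dim u=i+j\}$; these sets partition $P$. For $u\subseteq v$ in $P$ with $\dim v=\dim u+1$ and $u\in P_{i,j}$: $v$ $/$-covers $u$ if $v\in P_{i+1,j}$, and $v$ $\backslash$-covers $u$ if $v\in P_{i,j+1}$ (exactly one holds). In $\mathrm{Mat}_P(\mathbb{C})$: $E^*_{i,j}$ is the diagonal projection onto coordinates in $P_{i,j}$; $K_1,K_2$ are diagonal with $(u,u)$-entries $q^{D/2-i}$, $q^{(N-D)/2-j}$ for $u\in P_{i,j}$; $L_1$ (resp. $L_2$) has $(u,v)$-entry $1$ if $v$ $/$-covers (resp. $\backslash$-covers) $u$ and $0$ otherwise; $R_1=L_1^\top$, $R_2=L_2^\top$. $\mathcal{H}=\mathcal{H}(x)$ is the subalgebra generated by $L_1,L_2,R_1,R_2,K_1^{\pm1},K_2^{\pm1}$. Let $\Psi=\mathbb{C}^P$; $\mathcal{H}$-modules are $\mathcal{H}$-invariant subspaces of $\Psi$, irreducible if nonzero with no $\mathcal{H}$-submodule other than $0$ and itself. For each irreducible $\mathcal{H}$-module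 $\Omega$ there are unique integers $\alpha,\beta,\rho$ with $\rho\ge0$, $0\le\alpha\le\frac{D-\rho}{2}$, $0\le\beta\le\frac{N-D-\rho}{2}$ such that for $0\le i\le D$, $0\le j\le N-D$, $\dim E^*_{i,j}\Omega=1$ if $\alpha\le i\le D-\rho-\alpha$ and $\rho+\beta\le j\le N-D-\beta$, and $\dim E^*_{i,j}\Omega=0$ otherwise. The triple $(\alpha,\beta,\rho)$ is the type of $\Omega$. $\Omega$ is alpha-dominant with gap $\alpha$ if it has type $(\alpha,0,0)$ with $0\le\alpha\le\frac D2$. Regard $V$ as the subspace $\sum_{j=0}^{D}E^*_{D-j,j}\Psi$ of $\Psi$ (vectors supported on $X\subseteq P$). For an $\mathcal{H}$-submodule $\Omega\subseteq\Psi$ let $\widetilde{\Omega}=\sum_{j=0}^{D}E^*_{D-j,j}\Omega\subseteq V$. For a $T$-module $W$, let $W^{\mathcal{H}}$ be the intersection of all $\mathcal{H}$-submodules $\Omega\subseteq\Psi$ with $\widetilde{\Omega}=W$. *)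

theory Defs
  imports "HOL-Analysis.Analysis"
begin

text \<open>
  For a finite index type \<open>'i\<close> and \<open>S :: 'i set\<close>, the space of complex column vectors indexed
  by \<open>S\<close> is the space of vectors over \<open>'i\<close> vanishing off \<open>S\<close>, and the matrix algebra over \<open>S\<close>
  consists of the matrices over \<open>'i\<close> vanishing off \<open>S \<times> S\<close>; its unit is \<open>diag_on S (\<lambda>_. 1)\<close>.
\<close>

definition supported_vecs :: "'i::finite set \<Rightarrow> (complex ^ 'i) set" where
  "supported_vecs S = {v. \<forall>i. i \<notin> S \<longrightarrow> v $ i = 0}"

definition supported_mats :: "'i::finite set \<Rightarrow> (complex ^ 'i ^ 'i) set" where
  "supported_mats S = {M. \<forall>i j. i \<notin> S \<or> j \<notin> S \<longrightarrow> M $ i $ j = 0}"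

definition diag_on :: "'i::finite set \<Rightarrow> ('i \<Rightarrow> complex) \<Rightarrow> complex ^ 'i ^ 'i" where
  "diag_on S f = (\<chi> i j. if i = j \<and> i \<in> S then f i else 0)"

inductive_set gen_subalgebra ::
  "'i::finite set \<Rightarrow> (complex ^ 'i ^ 'i) set \<Rightarrow> (complex ^ 'i ^ 'i) set"
  for S :: "'i set" and G :: "(complex ^ 'i ^ 'i) set"
where
  gen: "M \<in> G \<Longrightarrow> M \<in> gen_subalgebra S G"
| unit: "diag_on S (\<lambda>_. 1) \<in> gen_subalgebra S G"
| add: "M \<in> gen_subalgebra S G \<Longrightarrow> M' \<in> gen_subalgebra S G \<Longrightarrow> M + M' \<in> gen_subalgebra S G"
| smult: "M \<in> gen_subalgebra S G \<Longrightarrow> (\<chi> i j. c * M $ i $ j) \<in> gen_subalgebra S G"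
| mult: "M \<in> gen_subalgebra S G \<Longrightarrow> M' \<in> gen_subalgebra S G \<Longrightarrow> M ** M' \<in> gen_subalgebra S G"

definition is_module ::
  "'i::finite set \<Rightarrow> (complex ^ 'i ^ 'i) set \<Rightarrow> (complex ^ 'i) set \<Rightarrow> bool" where
  "is_module S B W \<longleftrightarrow>
     vec.subspace W \<and> W \<subseteq> supported_vecs S \<and> (\<forall>M\<in>B. \<forall>w\<in>W. M *v w \<in> W)"

definition is_irreducible_module ::
  "'i::finite set \<Rightarrow> (complex ^ 'i ^ 'i) set \<Rightarrow> (complex ^ 'i) set \<Rightarrow> bool" where
  "is_irreducible_module S B W \<longleftrightarrow>
     is_module S B W \<and> W \<noteq> {0} \<and>
     (\<forall>U. is_module S B U \<and> U \<subseteq> W \<longrightarrow> U = {0} \<or> U = W)"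

definition hermitian_prod :: "complex ^ 'i \<Rightarrow> complex ^ 'i \<Rightarrow> complex" where
  "hermitian_prod v w = (\<Sum>i\<in>UNIV. v $ i * cnj (w $ i))"

definition orth_proj :: "'i::finite set \<Rightarrow> (complex ^ 'i) set \<Rightarrow> complex ^ 'i ^ 'i" where
  "orth_proj S U = (THE M. M \<in> supported_mats S \<and>
     (\<forall>v\<in>supported_vecs S. M *v v \<in> U \<and> (\<forall>w\<in>U. hermitian_prod (v - M *v v) w = 0)))"

text \<open>
  Finiteness of the type \<open>'v\<close> is no restriction: a finite-dimensional vector space over a
  finite field is a finite set.
\<close>

locale grassmann = vector_space scale
  for scale :: "'a::{field,finite} \<Rightarrow> 'v::{ab_group_add,finite} \<Rightarrow> 'v" +
  fixes q N D :: nat and x :: "'v set"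
  assumes card_field: "CARD('a) = q"
    and dim_UNIV: "dim (UNIV :: 'v set) = N"
    and D_ge_1: "D \<ge> 1"
    and N_gt: "N > 2 * D"
    and subspace_x: "subspace x"
    and dim_x: "dim x = D"
begin

definition bracket :: "nat \<Rightarrow> real" where
  "bracket l = (real q ^ l - 1) / (real q - 1)"

definition vertices :: "'v set set" where
  "vertices = {y. subspace y \<and> dim y = D}"

definition adjacent :: "'v set \<Rightarrow> 'v set \<Rightarrow> bool" where
  "adjacent y z \<longleftrightarrow> y \<in> vertices \<and> z \<in> vertices \<and> dim (y \<inter> z) = D - 1"

definition path_dist :: "'v set \<Rightarrow> 'v set \<Rightarrow> nat" where
  "path_dist y z = (LEAST n. (y, z) \<in> {(u, v). adjacent u v} ^^ n)"

definition adjacency_matrix :: "complex ^ 'v set ^ 'v set" where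
  "adjacency_matrix = (\<chi> y z. if adjacent y z then 1 else 0)"

definition eigval :: "nat \<Rightarrow> real" where
  "eigval i = real q * bracket D * bracket (N - D) - bracket i * bracket (N - i + 1)"

definition E :: "nat \<Rightarrow> complex ^ 'v set ^ 'v set" where
  "E i = orth_proj vertices
     {v \<in> supported_vecs vertices. adjacency_matrix *v v = complex_of_real (eigval i) *s v}"

definition E_star :: "nat \<Rightarrow> complex ^ 'v set ^ 'v set" where
  "E_star i = diag_on vertices (\<lambda>y. if path_dist x y = i then 1 else 0)"

definition T_algebra :: "(complex ^ 'v set ^ 'v set) set" where
  "T_algebra = gen_subalgebra vertices ({adjacency_matrix} \<union> E_star ` {0..D})"

definition irreducible_T_module :: "(complex ^ 'v set) set \<Rightarrow> bool" where
  "irreducible_T_module W \<longleftrightarrow> is_irreducible_module vertices T_algebra W"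

definition endpoint :: "(complex ^ 'v set) set \<Rightarrow> nat" where
  "endpoint W = (LEAST i. i \<le> D \<and> (*v) (E_star i) ` W \<noteq> {0})"

definition dual_endpoint :: "(complex ^ 'v set) set \<Rightarrow> nat" where
  "dual_endpoint W = (LEAST i. i \<le> D \<and> (*v) (E i) ` W \<noteq> {0})"

definition module_diameter :: "(complex ^ 'v set) set \<Rightarrow> int" where
  "module_diameter W = int (card {i. i \<le> D \<and> (*v) (E_star i) ` W \<noteq> {0}}) - 1"

definition displacement :: "(complex ^ 'v set) set \<Rightarrow> int" where
  "displacement W = int (endpoint W) + int (dual_endpoint W) - int D + module_diameter W"

definition nucleus :: "(complex ^ 'v set) set" where
  "nucleus = vec.span (\<Union>{W. irreducible_T_module W \<and> displacement W = 0})"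

definition P :: "'v set set" where
  "P = {u. subspace u}"

definition P_part :: "nat \<Rightarrow> nat \<Rightarrow> 'v set set" where
  "P_part i j = {u \<in> P. dim (u \<inter> x) = i \<and> dim u = i + j}"

definition slash_covers :: "'v set \<Rightarrow> 'v set \<Rightarrow> bool" where
  "slash_covers v u \<longleftrightarrow> u \<subseteq> v \<and> dim v = dim u + 1 \<and>
     (\<exists>i j. u \<in> P_part i j \<and> v \<in> P_part (i + 1) j)"

definition backslash_covers :: "'v set \<Rightarrow> 'v set \<Rightarrow> bool" where
  "backslash_covers v u \<longleftrightarrow> u \<subseteq> v \<and> dim v = dim u + 1 \<and>
     (\<exists>i j. u \<in> P_part i j \<and> v \<in> P_part i (j + 1))"

definition EP_star :: "nat \<Rightarrow> nat \<Rightarrow> complex ^ 'v set ^ 'v set" where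
  "EP_star i j = diag_on (P_part i j) (\<lambda>_. 1)"

text \<open>
  For \<open>u \<in> P_part i j\<close> one has \<open>i = dim (u \<inter> x)\<close> and \<open>j = dim u - dim (u \<inter> x)\<close>.
\<close>

definition K1_entry :: "'v set \<Rightarrow> complex" where
  "K1_entry u = complex_of_real (real q powr (real D / 2 - real (dim (u \<inter> x))))"

definition K2_entry :: "'v set \<Rightarrow> complex" where
  "K2_entry u = complex_of_real
     (real q powr (real (N - D) / 2 - (real (dim u) - real (dim (u \<inter> x)))))"

definition K1 :: "complex ^ 'v set ^ 'v set" where
  "K1 = diag_on P K1_entry"

definition K2 :: "complex ^ 'v set ^ 'v set" where
  "K2 = diag_on P K2_entry"

text \<open>Inverses are taken in the algebra of matrices indexed by \<open>P\<close>.\<close>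

definition K1_inv :: "complex ^ 'v set ^ 'v set" where
  "K1_inv = diag_on P (\<lambda>u. inverse (K1_entry u))"

definition K2_inv :: "complex ^ 'v set ^ 'v set" where
  "K2_inv = diag_on P (\<lambda>u. inverse (K2_entry u))"

definition L1 :: "complex ^ 'v set ^ 'v set" where
  "L1 = (\<chi> u v. if slash_covers v u then 1 else 0)"

definition L2 :: "complex ^ 'v set ^ 'v set" where
  "L2 = (\<chi> u v. if backslash_covers v u then 1 else 0)"

definition R1 :: "complex ^ 'v set ^ 'v set" where
  "R1 = transpose L1"

definition R2 :: "complex ^ 'v set ^ 'v set" where
  "R2 = transpose L2"

definition H_algebra :: "(complex ^ 'v set ^ 'v set) set" where
  "H_algebra = gen_subalgebra P {L1, L2, R1, R2, K1, K1_inv, K2, K2_inv}"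

definition H_module :: "(complex ^ 'v set) set \<Rightarrow> bool" where
  "H_module \<Omega> \<longleftrightarrow> is_module P H_algebra \<Omega>"

definition irreducible_H_module :: "(complex ^ 'v set) set \<Rightarrow> bool" where
  "irreducible_H_module \<Omega> \<longleftrightarrow> is_irreducible_module P H_algebra \<Omega>"

definition has_type :: "(complex ^ 'v set) set \<Rightarrow> nat \<Rightarrow> nat \<Rightarrow> nat \<Rightarrow> bool" where
  "has_type \<Omega> \<alpha> \<beta> \<rho> \<longleftrightarrow>
     irreducible_H_module \<Omega> \<and> 2 * \<alpha> + \<rho> \<le> D \<and> 2 * \<beta> + \<rho> \<le> N - D \<and>
     (\<forall>i\<le>D. \<forall>j\<le>N - D. vec.dim ((*v) (EP_star i j) ` \<Omega>) =
        (if \<alpha> \<le> i \<and> i \<le> D - \<rho> - \<alpha> \<and> \<rho> + \<beta> \<le> j \<and> j \<le> N - D - \<beta> then 1 else 0))"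

definition alpha_dominant :: "(complex ^ 'v set) set \<Rightarrow> nat \<Rightarrow> bool" where
  "alpha_dominant \<Omega> \<alpha> \<longleftrightarrow> has_type \<Omega> \<alpha> 0 0"

definition tilde :: "(complex ^ 'v set) set \<Rightarrow> (complex ^ 'v set) set" where
  "tilde \<Omega> = {(\<Sum>j\<le>D. f j) | f. \<forall>j\<le>D. f j \<in> (*v) (EP_star (D - j) j) ` \<Omega>}"

definition H_closure :: "(complex ^ 'v set) set \<Rightarrow> (complex ^ 'v set) set" where
  "H_closure W = \<Inter>{\<Omega>. H_module \<Omega> \<and> tilde \<Omega> = W}"

end

end

(*
  Write a function on subspaces as a vector and let R, L be the raising and lowering maps of the
  subspace lattice, so that A = R L - [D] on the vertices and L R - R L is a scalar on each level.
  Hence the theta_t-eigenspace of A consists of vectors R^(D-t) c with c supported on t-spaces.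

  If W' is irreducible with displacement 0 and dual endpoint t, then W' is supported at distance at
  most D-t from x, so it contains a nonzero v = R^(D-t) c with v(y) = 0 whenever dim(y Int x) < t.
  For a t-space w not inside x there is a subspace H of dimension at least D+t containing w with
  dim(H Int x) < t; as R^(D-t) is injective on the t-spaces of H, c(w) = 0. So c lives on the
  subspaces of x and v(y) depends only on y Int x. Functions of y Int x form a T-module, hence the
  nucleus consists of such functions.

  An irreducible T-module of such functions contains, at its lowest dimension alpha, the lift of
  some g on the alpha-subspaces of x with L g = 0. The lifts of the R^m g to the parts P_(alpha+m,j)
  span an irreducible H-module of type (alpha,0,0) that meets the vertex space in exactly W.
*)
theory Submission
  imports Defs
begin

section \<open>Subspaces of a finite vector space\<close>

context grassmann
begin

definition a_basis :: "'v set" where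
  "a_basis = (SOME B. independent B \<and> span B = UNIV)"

lemma a_basis: "independent a_basis" "span a_basis = UNIV"
proof -
  obtain B where "B \<subseteq> (UNIV :: 'v set)" "independent B" "UNIV \<subseteq> span B"
    using maximal_independent_subset by blast
  then have "\<exists>B. independent B \<and> span B = UNIV" by auto
  from someI_ex[OF this] show "independent a_basis" "span a_basis = UNIV"
    unfolding a_basis_def by auto
qed

sublocale fd: finite_dimensional_vector_space scale a_basis
  by unfold_locales (use a_basis in auto)

lemma q_ge_2: "q \<ge> 2"
proof -
  have "card {0, 1 :: 'a} \<le> CARD('a)" by (rule card_mono) auto
  then show ?thesis by (simp add: card_field)
qed

lemma card_span_independent:
  assumes "independent B"
  shows "card (span B) = q ^ card B"
proof -
  have "finite B" by simp
  then show ?thesis using assms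
  proof (induction B rule: finite_induct)
    case empty
    then show ?case by simp
  next
    case (insert a B)
    have ind: "independent B" and a: "a \<notin> span B"
      using insert by (auto simp: independent_insert split: if_splits)
    let ?f = "\<lambda>(k, t). scale k a + t"
    have inj: "inj_on ?f (UNIV \<times> span B)"
    proof (rule inj_onI, clarsimp)
      fix k t k' t' assume t: "t \<in> span B" "t' \<in> span B" and e: "scale k a + t = scale k' a + t'"
      have "scale (k - k') a = t' - t"
        using e by (simp add: scale_left_diff_distrib algebra_simps)
      then have s: "scale (k - k') a \<in> span B" using t by (simp add: span_diff)
      have "k = k'"
      proof (rule ccontr)
        assume "k \<noteq> k'"
        then have "a = scale (inverse (k - k')) (scale (k - k') a)" by simp
        then show False using a s span_scale by metis
      qed
      then show "k = k' \<and> t = t'" using e by simp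
    qed
    have im: "?f ` (UNIV \<times> span B) = span (insert a B)"
    proof
      show "?f ` (UNIV \<times> span B) \<subseteq> span (insert a B)"
      proof clarify
        fix k t assume "t \<in> span B"
        then have "(scale k a + t) - scale k a \<in> span B" by simp
        then show "scale k a + t \<in> span (insert a B)" unfolding span_insert by blast
      qed
      show "span (insert a B) \<subseteq> ?f ` (UNIV \<times> span B)"
      proof
        fix y assume "y \<in> span (insert a B)"
        then obtain k where "y - scale k a \<in> span B" by (auto simp: span_insert)
        then have "y = ?f (k, y - scale k a)" "(k, y - scale k a) \<in> UNIV \<times> span B" by auto
        then show "y \<in> ?f ` (UNIV \<times> span B)" by blast
      qed
    qed
    have "card (span (insert a B)) = CARD('a) * card (span B)"
      unfolding im[symmetric] by (simp add: card_image[OF inj] card_cartesian_product)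
    then show ?case using insert ind by (simp add: card_field)
  qed
qed

lemma card_subspace:
  assumes "subspace S"
  shows "card S = q ^ dim S"
proof -
  obtain B where B: "B \<subseteq> S" "independent B" "S \<subseteq> span B" "card B = dim S"
    using basis_exists by blast
  then have "span B = S" using assms span_subspace by blast
  then show ?thesis using card_span_independent[OF B(2)] B(4) by simp
qed

lemma dim_mono: "S \<subseteq> T \<Longrightarrow> dim S \<le> dim T"
  by (rule fd.dim_subset)

lemma dim_eqD: "subspace S \<Longrightarrow> subspace T \<Longrightarrow> S \<subseteq> T \<Longrightarrow> dim T \<le> dim S \<Longrightarrow> S = T"
  by (rule fd.subspace_dim_equal)

lemma dim_less: "subspace S \<Longrightarrow> subspace T \<Longrightarrow> S \<subset> T \<Longrightarrow> dim S < dim T"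
  using dim_eqD[of S T] dim_mono[of S T] by force

lemma dim_le_N: "dim S \<le> N"
  using dim_mono[of S UNIV] dim_UNIV by simp

definition ssum :: "'v set \<Rightarrow> 'v set \<Rightarrow> 'v set" (infixl "\<oplus>s" 65) where
  "S \<oplus>s T = {a + b | a b. a \<in> S \<and> b \<in> T}"

lemma subspace_ssum: "subspace S \<Longrightarrow> subspace T \<Longrightarrow> subspace (S \<oplus>s T)"
  unfolding ssum_def by (rule subspace_sums)

lemma dim_ssum: "subspace S \<Longrightarrow> subspace T \<Longrightarrow> dim (S \<oplus>s T) + dim (S \<inter> T) = dim S + dim T"
  unfolding ssum_def by (rule fd.dim_sums_Int)

lemma ssum_upper1: "subspace T \<Longrightarrow> S \<subseteq> S \<oplus>s T"
  unfolding ssum_def using subspace_0 by force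

lemma ssum_upper2: "subspace S \<Longrightarrow> T \<subseteq> S \<oplus>s T"
  unfolding ssum_def using subspace_0 by force

lemma ssum_least: "subspace U \<Longrightarrow> S \<subseteq> U \<Longrightarrow> T \<subseteq> U \<Longrightarrow> S \<oplus>s T \<subseteq> U"
  unfolding ssum_def using subspace_add by blast

lemma ssum_absorb: "subspace S \<Longrightarrow> subspace T \<Longrightarrow> S \<subseteq> T \<Longrightarrow> S \<oplus>s T = T"
  by (meson order_refl ssum_least ssum_upper2 subset_antisym)

lemma modular_law:
  assumes "subspace C" "A \<subseteq> C"
  shows "(A \<oplus>s B) \<inter> C = A \<oplus>s (B \<inter> C)"
proof
  show "(A \<oplus>s B) \<inter> C \<subseteq> A \<oplus>s (B \<inter> C)"
  proof
    fix z assume "z \<in> (A \<oplus>s B) \<inter> C"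
    then obtain a b where ab: "z = a + b" "a \<in> A" "b \<in> B" "z \<in> C"
      unfolding ssum_def by blast
    then have "b = z - a" "a \<in> C" using assms by auto
    then have "b \<in> C" using ab assms subspace_diff by blast
    then show "z \<in> A \<oplus>s (B \<inter> C)" using ab unfolding ssum_def by blast
  qed
  show "A \<oplus>s (B \<inter> C) \<subseteq> (A \<oplus>s B) \<inter> C"
    using assms subspace_add unfolding ssum_def by blast
qed

lemma dim_line_ssum:
  assumes "subspace S" "a \<notin> S"
  shows "dim (span {a} \<oplus>s S) = Suc (dim S)" "a \<in> span {a} \<oplus>s S"
proof -
  have e: "span S = S" using assms(1) by (simp add: span_eq_iff)
  have a: "a \<notin> span S" unfolding e by (rule assms(2))
  have "span {a} \<oplus>s S = span (insert a S)"
    using span_Un[of "{a}" S] unfolding ssum_def e by simp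
  moreover have "dim (insert a S) = Suc (dim S)"
    using a fd.dim_insert[of a S] by (simp only: if_False Suc_eq_plus1)
  ultimately show "dim (span {a} \<oplus>s S) = Suc (dim S)" by simp
  show "a \<in> span {a} \<oplus>s S"
    using ssum_upper1[OF assms(1), of "span {a}"] span_base[of a "{a}"] by auto
qed

lemma exists_extension:
  assumes "subspace A" "subspace B" "subspace T" "A \<subseteq> T" "B \<subseteq> T"
    and "dim (A \<oplus>s B) + m \<le> dim T"
  shows "\<exists>H. subspace H \<and> A \<subseteq> H \<and> H \<subseteq> T \<and> H \<inter> B = A \<inter> B \<and> dim H = dim A + m"
  using assms(6)
proof (induction m)
  case 0
  then show ?case using assms by auto
next
  case (Suc m)
  then obtain H where H: "subspace H" "A \<subseteq> H" "H \<subseteq> T" "H \<inter> B = A \<inter> B" "dim H = dim A + m"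
    by auto
  have dHB: "dim (H \<oplus>s B) = dim (A \<oplus>s B) + m"
    using dim_ssum[OF H(1) assms(2)] dim_ssum[OF assms(1,2)] H by simp
  have sHB: "subspace (H \<oplus>s B)" using H assms subspace_ssum by blast
  have "H \<oplus>s B \<subseteq> T" using H assms ssum_least by blast
  moreover have "H \<oplus>s B \<noteq> T" using dHB Suc.prems by auto
  ultimately obtain a where a: "a \<in> T" "a \<notin> H \<oplus>s B" by blast
  let ?H = "span {a} \<oplus>s H"
  have aH: "a \<notin> H" using a ssum_upper1[OF assms(2)] by blast
  have sH: "subspace ?H" using H subspace_ssum by blast
  have dim: "dim ?H = Suc (dim H)" using dim_line_ssum[OF H(1) aH] by blast
  have sub: "H \<subseteq> ?H" using ssum_upper2 by blast
  have "?H \<subseteq> T"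
    using a H assms by (intro ssum_least) (auto simp: span_minimal)
  moreover have "?H \<inter> B = H \<inter> B"
  proof -
    have "?H \<oplus>s B = span {a} \<oplus>s (H \<oplus>s B)"
      unfolding ssum_def by (auto; metis add.assoc)
    then have "dim (?H \<oplus>s B) = Suc (dim (H \<oplus>s B))"
      using dim_line_ssum[OF sHB a(2)] by simp
    then have "dim (?H \<inter> B) = dim (H \<inter> B)"
      using dim_ssum[OF sH assms(2)] dim_ssum[OF H(1) assms(2)] dim by simp
    moreover have "subspace (H \<inter> B)" "subspace (?H \<inter> B)" "H \<inter> B \<subseteq> ?H \<inter> B"
      using sub H(1) sH assms(2) subspace_inter by auto
    ultimately show ?thesis by (metis dim_eqD order_refl)
  qed
  ultimately show ?case using sH dim sub H by (intro exI[of _ ?H]) auto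
qed

lemma exists_between:
  assumes "subspace A" "subspace T" "A \<subseteq> T" "dim A \<le> n" "n \<le> dim T"
  shows "\<exists>H. subspace H \<and> A \<subseteq> H \<and> H \<subseteq> T \<and> dim H = n"
proof -
  have "A \<oplus>s A = A" using assms ssum_absorb by blast
  then show ?thesis
    using exists_extension[OF assms(1,1,2,3,3), of "n - dim A"] assms by auto
qed

end

section \<open>Counting covers and hyperplanes\<close>

context grassmann
begin

lemma bracket_0 [simp]: "bracket 0 = 0"
  by (simp add: bracket_def)

lemma bracket_Suc: "bracket (Suc n) = bracket n + real q ^ n"
  using q_ge_2 by (simp add: bracket_def field_simps)

lemma bracket_1 [simp]: "bracket (Suc 0) = 1"
  by (simp add: bracket_Suc)

lemma bracket_strict_mono: "m < n \<Longrightarrow> bracket m < bracket n"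
  using q_ge_2 by (simp add: bracket_def divide_strict_right_mono)

lemma bracket_pos: "0 < n \<Longrightarrow> 0 < bracket n"
  using bracket_strict_mono[of 0 n] by simp

definition cov :: "'v set \<Rightarrow> 'v set \<Rightarrow> 'v set set" where
  "cov T w = {y. subspace y \<and> w \<subseteq> y \<and> y \<subseteq> T \<and> dim y = Suc (dim w)}"

definition hyp :: "'v set \<Rightarrow> 'v set set" where
  "hyp y = {h. subspace h \<and> h \<subseteq> y \<and> dim y = Suc (dim h)}"

lemma line_ssum_in_cov:
  assumes "subspace w" "subspace T" "w \<subseteq> T" "a \<in> T" "a \<notin> w"
  shows "span {a} \<oplus>s w \<in> cov T w"
proof -
  have "span {a} \<oplus>s w \<subseteq> T" using assms by (intro ssum_least) (auto simp: span_minimal)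
  then show ?thesis
    unfolding cov_def
    using subspace_ssum[OF subspace_span assms(1)] ssum_upper2[OF subspace_span]
      dim_line_ssum(1)[OF assms(1,5)] by blast
qed

lemma cov_eq_line_ssum:
  assumes "subspace w" "y \<in> cov T w" "a \<in> y" "a \<notin> w"
  shows "y = span {a} \<oplus>s w"
proof -
  have y: "subspace y" "w \<subseteq> y" "dim y = Suc (dim w)" using assms(2) by (auto simp: cov_def)
  have "span {a} \<oplus>s w \<subseteq> y" using y assms(3) by (intro ssum_least) (auto simp: span_minimal)
  then show ?thesis
    using dim_eqD[of "span {a} \<oplus>s w" y] dim_line_ssum[OF assms(1,4)] y assms(1) subspace_ssum
    by auto
qed

lemma card_cov:
  assumes "subspace w" "subspace T" "w \<subseteq> T"
  shows "real (card (cov T w)) = bracket (dim T - dim w)"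
proof -
  have U: "T - w = (\<Union>y\<in>cov T w. y - w)"
    using line_ssum_in_cov[OF assms] dim_line_ssum(2)[OF assms(1)] by (fastforce simp: cov_def)
  have "card (T - w) = (\<Sum>y\<in>cov T w. card (y - w))"
    unfolding U using cov_eq_line_ssum[OF assms(1)]
    by (intro card_UN_disjoint) (auto, blast+)
  also have "\<dots> = (\<Sum>y\<in>cov T w. q ^ Suc (dim w) - q ^ dim w)"
  proof (rule sum.cong[OF refl])
    fix y assume "y \<in> cov T w"
    then have y: "subspace y" "w \<subseteq> y" "dim y = Suc (dim w)" by (auto simp: cov_def)
    then show "card (y - w) = q ^ Suc (dim w) - q ^ dim w"
      using card_subspace[OF assms(1)] card_subspace[of y] by (simp add: card_Diff_subset)
  qed
  finally have *: "q ^ dim T - q ^ dim w = card (cov T w) * (q ^ Suc (dim w) - q ^ dim w)"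
    using assms card_subspace by (simp add: card_Diff_subset)
  have le: "dim w \<le> dim T" using assms dim_mono by blast
  have p: "q ^ dim w \<le> q ^ dim T" "q ^ dim w \<le> q ^ Suc (dim w)"
    using q_ge_2 le by (auto intro!: power_increasing)
  have "real (q ^ dim T - q ^ dim w) = real (card (cov T w)) * real (q ^ Suc (dim w) - q ^ dim w)"
    unfolding * by simp
  then have "real q ^ dim T - real q ^ dim w
      = real (card (cov T w)) * (real q ^ Suc (dim w) - real q ^ dim w)"
    using p by (simp add: of_nat_diff del: power_Suc)
  moreover have "real q ^ dim T = real q ^ (dim T - dim w) * real q ^ dim w"
    using le by (simp flip: power_add)
  ultimately have "(real q ^ (dim T - dim w) - 1) * real q ^ dim w
      = (real (card (cov T w)) * (real q - 1)) * real q ^ dim w"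
    by (simp add: algebra_simps)
  then have "real q ^ (dim T - dim w) - 1 = real (card (cov T w)) * (real q - 1)"
    using q_ge_2 by simp
  then show ?thesis using q_ge_2 by (simp add: bracket_def field_simps)
qed

lemma mem_cov_iff_mem_hyp:
  "subspace w \<Longrightarrow> y \<in> cov T w \<longleftrightarrow> subspace y \<and> y \<subseteq> T \<and> w \<in> hyp y"
  unfolding cov_def hyp_def by blast

text \<open>Double counting of the flags \<open>u \<subset> p \<subseteq> h \<subset> y\<close> with \<open>p\<close> covering \<open>u\<close> and
  \<open>h\<close> a hyperplane of \<open>y\<close>.\<close>

lemma card_hyp_above:
  assumes "subspace u" "subspace y" "u \<subseteq> y"
  shows "real (card {h \<in> hyp y. u \<subseteq> h}) = bracket (dim y - dim u)"
  using assms
proof (induction "dim y - dim u" arbitrary: u)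
  case 0
  then have "u = y" using dim_eqD[of u y] by auto
  then have "{h \<in> hyp y. u \<subseteq> h} = {}" by (auto simp: hyp_def)
  then show ?case using 0 by simp
next
  case (Suc m)
  show ?case
  proof (cases "m = 0")
    case True
    have "{h \<in> hyp y. u \<subseteq> h} = {u}"
    proof (intro set_eqI iffI)
      fix h assume "h \<in> {h \<in> hyp y. u \<subseteq> h}"
      then have "subspace h" "u \<subseteq> h" "dim h \<le> dim u"
        using Suc.hyps(2) True by (auto simp: hyp_def)
      then show "h \<in> {u}" using dim_eqD[of u h] Suc.prems by auto
    next
      fix h assume "h \<in> {u}"
      then show "h \<in> {h \<in> hyp y. u \<subseteq> h}"
        using Suc.hyps(2) Suc.prems True by (auto simp: hyp_def)
    qed
    moreover have "dim y - dim u = Suc 0" using Suc.hyps(2) True by simp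
    ultimately show ?thesis by (simp only: bracket_1) simp
  next
    case False
    let ?Hy = "{h \<in> hyp y. u \<subseteq> h}"
    have "(\<Sum>h\<in>?Hy. \<Sum>p\<in>cov y u. if p \<subseteq> h then 1 else 0)
        = (\<Sum>h\<in>?Hy. bracket m)"
    proof (rule sum.cong[OF refl])
      fix h assume "h \<in> ?Hy"
      then have h: "subspace h" "h \<subseteq> y" "u \<subseteq> h" "dim y = Suc (dim h)" by (auto simp: hyp_def)
      have "{p \<in> cov y u. p \<subseteq> h} = cov h u" using h by (auto simp: cov_def)
      then have "(\<Sum>p\<in>cov y u. if p \<subseteq> h then 1 else 0) = real (card (cov h u))"
        by (simp flip: sum.inter_filter)
      also have "\<dots> = bracket (dim h - dim u)" using card_cov[of u h] h Suc.prems by blast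
      also have "dim h - dim u = m" using h(4) Suc.hyps(2) by linarith
      finally show "(\<Sum>p\<in>cov y u. if p \<subseteq> h then 1 else 0) = bracket m" .
    qed
    moreover have "(\<Sum>p\<in>cov y u. \<Sum>h\<in>?Hy. if p \<subseteq> h then 1 else 0)
        = (\<Sum>p\<in>cov y u. bracket m)"
    proof (rule sum.cong[OF refl])
      fix p assume "p \<in> cov y u"
      then have p: "subspace p" "p \<subseteq> y" "u \<subseteq> p" "dim p = Suc (dim u)" by (auto simp: cov_def)
      have "{h \<in> ?Hy. p \<subseteq> h} = {h \<in> hyp y. p \<subseteq> h}" using p by auto
      then have "(\<Sum>h\<in>?Hy. if p \<subseteq> h then 1 else 0) = real (card {h \<in> hyp y. p \<subseteq> h})"
        by (simp flip: sum.inter_filter)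
      also have "\<dots> = bracket (dim y - dim p)"
        using p(4) Suc.hyps(2) by (intro Suc.hyps(1) p Suc.prems) linarith
      also have "dim y - dim p = m" using p(4) Suc.hyps(2) by linarith
      finally show "(\<Sum>h\<in>?Hy. if p \<subseteq> h then 1 else 0) = bracket m" .
    qed
    ultimately have "real (card (cov y u)) * bracket m = real (card ?Hy) * bracket m"
      using sum.swap[of "\<lambda>h p. if p \<subseteq> h then 1 else 0 :: real" "cov y u" ?Hy] by simp
    then have "real (card ?Hy) = real (card (cov y u))" using False bracket_pos[of m] by simp
    then show ?thesis using card_cov[OF Suc.prems] by simp
  qed
qed

lemma card_hyp:
  assumes "subspace y"
  shows "real (card (hyp y)) = bracket (dim y)"
proof -
  have "{h \<in> hyp y. {0} \<subseteq> h} = hyp y" using subspace_0 by (auto simp: hyp_def)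
  then show ?thesis using card_hyp_above[of "{0}" y] assms subspace_0 by simp
qed

definition adj_in :: "'v set \<Rightarrow> 'v set \<Rightarrow> 'v set set" where
  "adj_in T w = {w'. subspace w' \<and> w' \<subseteq> T \<and> dim w' = dim w \<and> Suc (dim (w \<inter> w')) = dim w}"

lemma sum_cov_hyp:
  fixes c :: "'v set \<Rightarrow> complex"
  assumes "subspace w" "subspace T" "w \<subseteq> T"
  shows "(\<Sum>y\<in>cov T w. \<Sum>w'\<in>hyp y. c w')
    = of_real (bracket (dim T - dim w)) * c w + (\<Sum>w'\<in>adj_in T w. c w')"
proof -
  have "(\<Sum>y\<in>cov T w. \<Sum>w'\<in>hyp y. c w') = (\<Sum>y\<in>cov T w. c w + (\<Sum>w'\<in>hyp y - {w}. c w'))"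
    by (rule sum.cong[OF refl], rule sum.remove) (use assms mem_cov_iff_mem_hyp in auto)
  also have "\<dots> = of_nat (card (cov T w)) * c w + (\<Sum>y\<in>cov T w. \<Sum>w'\<in>hyp y - {w}. c w')"
    by (simp add: sum.distrib)
  also have "(of_nat (card (cov T w)) :: complex) = of_real (bracket (dim T - dim w))"
    using card_cov[OF assms] by (metis of_real_of_nat_eq)
  also have "(\<Sum>y\<in>cov T w. \<Sum>w'\<in>hyp y - {w}. c w')
      = (\<Sum>(y, w')\<in>Sigma (cov T w) (\<lambda>y. hyp y - {w}). c w')"
    by (rule sum.Sigma) auto
  also have "\<dots> = (\<Sum>w'\<in>adj_in T w. c w')"
  proof (rule sum.reindex_bij_witness[where i = "\<lambda>w'. (w \<oplus>s w', w')" and j = snd], goal_cases)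
    case (1 a)
    obtain y w' where a: "a = (y, w')" by (cases a)
    with 1 have y: "subspace y" "w \<subseteq> y" "y \<subseteq> T" "dim y = Suc (dim w)" "subspace w'" "w' \<subseteq> y"
      "dim w' = dim w" "w' \<noteq> w" by (auto simp: cov_def hyp_def)
    have "w \<oplus>s w' \<subseteq> y" using y ssum_least by blast
    moreover have "\<not> w' \<subseteq> w" using y(5-8) dim_eqD[of w' w] assms(1) by auto
    then have "w \<subset> w \<oplus>s w'" using ssum_upper1[of w' w] ssum_upper2[of w w'] y assms by blast
    then have "dim w < dim (w \<oplus>s w')"
      by (rule dim_less[OF assms(1) subspace_ssum[OF assms(1) y(5)]])
    ultimately have "w \<oplus>s w' = y" using dim_eqD[of "w \<oplus>s w'" y] y(1,4) subspace_ssum[OF assms(1) y(5)] by auto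
    then show ?case using a by simp
  next
    case (2 a)
    obtain y w' where a: "a = (y, w')" by (cases a)
    with 2 have y: "subspace y" "w \<subseteq> y" "y \<subseteq> T" "dim y = Suc (dim w)" "subspace w'" "w' \<subseteq> y"
      "dim w' = dim w" "w' \<noteq> w" by (auto simp: cov_def hyp_def)
    have le: "dim (w \<oplus>s w') \<le> dim y" using ssum_least[OF y(1,2,6)] by (rule dim_mono)
    have "\<not> w \<subseteq> w'" using y(5-8) dim_eqD[of w w'] assms(1) by auto
    then have "dim (w \<inter> w') < dim w" using dim_less[of "w \<inter> w'" w] assms(1) y(5) subspace_inter[of w w'] by blast
    then have "Suc (dim (w \<inter> w')) = dim w"
      using dim_ssum[of w w'] assms y le by simp
    then show ?case using a y by (auto simp: adj_in_def)
  next
    case (3 w')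
    then show ?case by simp
  next
    case (4 w')
    then have w': "subspace w'" "w' \<subseteq> T" "dim w' = dim w" "Suc (dim (w \<inter> w')) = dim w"
      by (auto simp: adj_in_def)
    then have "w \<oplus>s w' \<in> cov T w" "w' \<in> hyp (w \<oplus>s w')" "w' \<noteq> w"
      using dim_ssum[of w w'] assms ssum_least[of T w w'] ssum_upper1[of w' w] ssum_upper2[of w w']
        subspace_ssum[of w w']
      by (auto simp: cov_def hyp_def)
    then show ?case by auto
  next
    case (5 a)
    then show ?case by (auto split: prod.split)
  qed
  finally show ?thesis .
qed

lemma sum_hyp_cov:
  fixes c :: "'v set \<Rightarrow> complex"
  assumes "subspace w" "subspace T" "w \<subseteq> T"
  shows "(\<Sum>h\<in>hyp w. \<Sum>w'\<in>cov T h. c w')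
    = of_real (bracket (dim w)) * c w + (\<Sum>w'\<in>adj_in T w. c w')"
proof -
  have "(\<Sum>h\<in>hyp w. \<Sum>w'\<in>cov T h. c w') = (\<Sum>h\<in>hyp w. c w + (\<Sum>w'\<in>cov T h - {w}. c w'))"
    by (rule sum.cong[OF refl], rule sum.remove) (use assms in \<open>auto simp: cov_def hyp_def\<close>)
  also have "\<dots> = of_nat (card (hyp w)) * c w + (\<Sum>h\<in>hyp w. \<Sum>w'\<in>cov T h - {w}. c w')"
    by (simp add: sum.distrib)
  also have "(of_nat (card (hyp w)) :: complex) = of_real (bracket (dim w))"
    using card_hyp[OF assms(1)] by (metis of_real_of_nat_eq)
  also have "(\<Sum>h\<in>hyp w. \<Sum>w'\<in>cov T h - {w}. c w')
      = (\<Sum>(h, w')\<in>Sigma (hyp w) (\<lambda>h. cov T h - {w}). c w')"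
    by (rule sum.Sigma) auto
  also have "\<dots> = (\<Sum>w'\<in>adj_in T w. c w')"
  proof (rule sum.reindex_bij_witness[where i = "\<lambda>w'. (w \<inter> w', w')" and j = snd], goal_cases)
    case (1 a)
    obtain h w' where a: "a = (h, w')" by (cases a)
    with 1 have h: "subspace h" "h \<subseteq> w" "dim w = Suc (dim h)" "subspace w'" "w' \<subseteq> T" "h \<subseteq> w'"
      "dim w' = dim w" "w' \<noteq> w" by (auto simp: cov_def hyp_def)
    have "\<not> w \<subseteq> w'" using h(4-8) dim_eqD[of w w'] assms(1) by auto
    then have "dim (w \<inter> w') < dim w" using dim_less[of "w \<inter> w'" w] assms(1) h(4) subspace_inter[of w w'] by blast
    then have "h = w \<inter> w'" using dim_eqD[of h "w \<inter> w'"] h assms subspace_inter by auto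
    then show ?case using a by simp
  next
    case (2 a)
    obtain h w' where a: "a = (h, w')" by (cases a)
    with 2 have h: "subspace h" "h \<subseteq> w" "dim w = Suc (dim h)" "subspace w'" "w' \<subseteq> T" "h \<subseteq> w'"
      "dim w' = dim w" "w' \<noteq> w" by (auto simp: cov_def hyp_def)
    have "\<not> w \<subseteq> w'" using h(4-8) dim_eqD[of w w'] assms(1) by auto
    then have "dim (w \<inter> w') < dim w" using dim_less[of "w \<inter> w'" w] assms(1) h(4) subspace_inter[of w w'] by blast
    moreover have "dim h \<le> dim (w \<inter> w')" using h by (intro dim_mono) auto
    ultimately show ?case using a h by (auto simp: adj_in_def)
  next
    case (3 w')
    then show ?case by simp
  next
    case (4 w')
    then show ?case
      using assms subspace_inter[of w w'] by (auto simp: adj_in_def cov_def hyp_def)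
  next
    case (5 a)
    then show ?case by (auto split: prod.split)
  qed
  finally show ?thesis .
qed

end

section \<open>Raising and lowering on the subspace lattice\<close>

lemma hermitian_prod_self: "hermitian_prod v v = of_real (\<Sum>i\<in>UNIV. (cmod (v $ i))\<^sup>2)"
  unfolding hermitian_prod_def complex_norm_square[symmetric] by simp

lemma hermitian_prod_self_eq_0: "hermitian_prod v v = 0 \<longleftrightarrow> v = (0 :: complex ^ 'i::finite)"
  unfolding hermitian_prod_self of_real_eq_0_iff
  by (simp add: sum_nonneg_eq_0_iff vec_eq_iff)

lemma hermitian_prod_transpose:
  fixes M :: "complex ^ 'i::finite ^ 'i"
  assumes "\<And>i j. M $ i $ j \<in> \<real>"
  shows "hermitian_prod (M *v v) w = hermitian_prod v (transpose M *v w)"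
proof -
  have "hermitian_prod (M *v v) w = (\<Sum>i\<in>UNIV. \<Sum>j\<in>UNIV. M $ i $ j * v $ j * cnj (w $ i))"
    by (simp add: hermitian_prod_def matrix_vector_mult_def sum_distrib_right)
  also have "\<dots> = (\<Sum>j\<in>UNIV. \<Sum>i\<in>UNIV. M $ i $ j * v $ j * cnj (w $ i))"
    by (rule sum.swap)
  also have "\<dots> = hermitian_prod v (transpose M *v w)"
    unfolding hermitian_prod_def matrix_vector_mult_def transpose_def
    using assms by (simp add: sum_distrib_left Reals_cnj_iff mult_ac)
  finally show ?thesis .
qed

lemma hermitian_prod_simps:
  fixes u v w :: "complex ^ 'i::finite"
  shows "hermitian_prod (c *s v) w = c * hermitian_prod v w"
    and "hermitian_prod v (c *s w) = cnj c * hermitian_prod v w"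
    and "hermitian_prod (u - v) w = hermitian_prod u w - hermitian_prod v w"
    and "hermitian_prod (u + v) w = hermitian_prod u w + hermitian_prod v w"
    and "hermitian_prod u (v - w) = hermitian_prod u v - hermitian_prod u w"
    and "hermitian_prod 0 w = 0"
  by (simp_all add: hermitian_prod_def sum_distrib_left sum_subtractf sum.distrib algebra_simps)

lemma hermitian_prod_sum:
  "hermitian_prod (\<Sum>k\<in>K. f k) w = (\<Sum>k\<in>K. hermitian_prod (f k) (w :: complex ^ 'i::finite))"
  by (induction K rule: infinite_finite_induct) (simp_all add: hermitian_prod_simps)

lemma matrix_vector_mult_smult: "M *v (c *s v) = c *s (M *v v)" for M :: "complex ^ 'i::finite ^ 'j::finite"
  by (rule vec.scale)

lemma matrix_vector_mult_sum:
  "M *v (\<Sum>k\<in>K. f k) = (\<Sum>k\<in>K. M *v f k)" for M :: "complex ^ 'i::finite ^ 'j::finite"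
  by (rule vec.sum)

context grassmann
begin

definition up :: "'v set \<Rightarrow> complex ^ 'v set ^ 'v set" where
  "up T = (\<chi> y h. if subspace y \<and> y \<subseteq> T \<and> h \<in> hyp y then 1 else 0)"

definition down :: "'v set \<Rightarrow> complex ^ 'v set ^ 'v set" where
  "down T = transpose (up T)"

lemma up_nth: "(up T *v c) $ y = (if subspace y \<and> y \<subseteq> T then \<Sum>h\<in>hyp y. c $ h else 0)"
proof -
  have "(up T *v c) $ y
      = (\<Sum>h\<in>UNIV. if h \<in> (if subspace y \<and> y \<subseteq> T then hyp y else {}) then c $ h else 0)"
    unfolding up_def matrix_vector_mult_def vec_lambda_beta by (rule sum.cong) auto
  also have "\<dots> = (\<Sum>h\<in>(if subspace y \<and> y \<subseteq> T then hyp y else {}). c $ h)"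
    by (subst sum.inter_restrict[symmetric]) auto
  finally show ?thesis by simp
qed

lemma down_nth: "(down T *v c) $ w = (if subspace w then \<Sum>y\<in>cov T w. c $ y else 0)"
proof -
  have "(down T *v c) $ w = (\<Sum>y\<in>UNIV. if subspace y \<and> y \<subseteq> T \<and> w \<in> hyp y then c $ y else 0)"
    unfolding down_def up_def transpose_def matrix_vector_mult_def by (auto intro!: sum.cong)
  also have "\<dots> = (\<Sum>y\<in>UNIV. if y \<in> (if subspace w then cov T w else {}) then c $ y else 0)"
    by (rule sum.cong[OF refl]) (auto simp: cov_def hyp_def)
  also have "\<dots> = (\<Sum>y\<in>(if subspace w then cov T w else {}). c $ y)"
    by (subst sum.inter_restrict[symmetric]) auto
  finally show ?thesis by simp
qed

definition level_vecs :: "'v set \<Rightarrow> nat \<Rightarrow> (complex ^ 'v set) set" where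
  "level_vecs T i = {c. \<forall>w. c $ w \<noteq> 0 \<longrightarrow> subspace w \<and> w \<subseteq> T \<and> dim w = i}"

lemma level_vecsD: "c \<in> level_vecs T i \<Longrightarrow> c $ w \<noteq> 0 \<Longrightarrow> subspace w \<and> w \<subseteq> T \<and> dim w = i"
  unfolding level_vecs_def by blast

lemma subspace_level_vecs: "vec.subspace (level_vecs T i)"
proof -
  have "level_vecs T i = {c. \<forall>w. \<not> (subspace w \<and> w \<subseteq> T \<and> dim w = i) \<longrightarrow> c $ w = 0}"
    unfolding level_vecs_def by blast
  then show ?thesis unfolding vec.subspace_def by simp
qed

lemma up_level_vecs:
  assumes "c \<in> level_vecs T i"
  shows "up T *v c \<in> level_vecs T (Suc i)"
  unfolding level_vecs_def
proof clarify
  fix y assume "(up T *v c) $ y \<noteq> 0"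
  then have y: "subspace y" "y \<subseteq> T" and "(\<Sum>h\<in>hyp y. c $ h) \<noteq> 0"
    by (auto simp: up_nth split: if_splits)
  then obtain h where "h \<in> hyp y" "c $ h \<noteq> 0" by (meson sum.neutral)
  then have "dim y = Suc i" using level_vecsD[OF assms] unfolding hyp_def by auto
  then show "subspace y \<and> y \<subseteq> T \<and> dim y = Suc i" using y by blast
qed

lemma down_level_vecs:
  assumes "c \<in> level_vecs T (Suc i)"
  shows "down T *v c \<in> level_vecs T i"
  unfolding level_vecs_def
proof clarify
  fix w assume "(down T *v c) $ w \<noteq> 0"
  then have w: "subspace w" and "(\<Sum>y\<in>cov T w. c $ y) \<noteq> 0"
    by (auto simp: down_nth split: if_splits)
  then obtain y where y: "y \<in> cov T w" "c $ y \<noteq> 0" by (meson sum.neutral)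
  then have "dim y = Suc i" using level_vecsD[OF assms] by blast
  then show "subspace w \<and> w \<subseteq> T \<and> dim w = i" using w y unfolding cov_def by auto
qed

lemma down_level_vecs_0:
  assumes "c \<in> level_vecs T 0"
  shows "down T *v c = 0"
proof (rule ccontr)
  assume "down T *v c \<noteq> 0"
  then obtain w where "(down T *v c) $ w \<noteq> 0" by (auto simp: vec_eq_iff)
  then have w: "subspace w" and "(\<Sum>y\<in>cov T w. c $ y) \<noteq> 0"
    by (auto simp: down_nth split: if_splits)
  then obtain y where y: "y \<in> cov T w" "c $ y \<noteq> 0" by (meson sum.neutral)
  then have "dim y = 0" using level_vecsD[OF assms] by blast
  moreover have "dim y = Suc (dim w)" using y(1) unfolding cov_def by blast
  ultimately show False by linarith
qed

lemma up_down_nth: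
  assumes "subspace y" "subspace T" "y \<subseteq> T"
  shows "(up T *v (down T *v c)) $ y
    = of_real (bracket (dim y)) * c $ y + (\<Sum>w\<in>adj_in T y. c $ w)"
proof -
  have "(up T *v (down T *v c)) $ y = (\<Sum>h\<in>hyp y. \<Sum>w\<in>cov T h. c $ w)"
    using assms by (auto simp: up_nth down_nth hyp_def intro!: sum.cong)
  then show ?thesis using sum_hyp_cov[OF assms, of "($) c"] by simp
qed

lemma down_up_nth:
  assumes "subspace w" "subspace T" "w \<subseteq> T"
  shows "(down T *v (up T *v c)) $ w
    = of_real (bracket (dim T - dim w)) * c $ w + (\<Sum>w\<in>adj_in T w. c $ w)"
proof -
  have "(down T *v (up T *v c)) $ w = (\<Sum>y\<in>cov T w. \<Sum>w'\<in>hyp y. c $ w')"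
    using assms by (auto simp: up_nth down_nth cov_def intro!: sum.cong)
  then show ?thesis using sum_cov_hyp[OF assms, of "($) c"] by simp
qed

lemma down_up:
  assumes "subspace T" "c \<in> level_vecs T i"
  shows "down T *v (up T *v c)
    = up T *v (down T *v c) + complex_of_real (bracket (dim T - i) - bracket i) *s c"
proof (rule vec_eq_iff[THEN iffD2], rule allI)
  fix w
  show "(down T *v (up T *v c)) $ w
    = (up T *v (down T *v c) + complex_of_real (bracket (dim T - i) - bracket i) *s c) $ w"
  proof (cases "subspace w \<and> w \<subseteq> T")
    case True
    show ?thesis
    proof (cases "c $ w = 0")
      case False
      then have "dim w = i" using level_vecsD[OF assms(2)] by blast
      then show ?thesis
        using True assms(1) by (simp add: up_down_nth down_up_nth algebra_simps)
    qed (use True assms(1) in \<open>simp add: up_down_nth down_up_nth\<close>)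
  next
    case False
    then have "c $ w = 0" using level_vecsD[OF assms(2)] by blast
    moreover have "(down T *v (up T *v c)) $ w = 0"
      using False down_level_vecs[OF up_level_vecs[OF assms(2)]] level_vecsD by blast
    ultimately show ?thesis using False by (auto simp: up_nth)
  qed
qed

definition weight :: "nat \<Rightarrow> nat \<Rightarrow> real" where
  "weight M i = bracket i * bracket (M + 1 - i)"

lemma weight_Suc:
  assumes "i \<le> M"
  shows "weight M (Suc i) = weight M i + (bracket (M - i) - bracket i)"
proof -
  have q: "real q - 1 \<noteq> 0" using q_ge_2 by simp
  have 1: "bracket (M + 1 - i) = bracket (M - i) + real q ^ (M - i)"
    using assms bracket_Suc[of "M - i"] by (simp add: Suc_diff_le)
  have 2: "real q ^ i = bracket i * (real q - 1) + 1" "real q ^ (M - i) = bracket (M - i) * (real q - 1) + 1"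
    using q by (auto simp: bracket_def)
  show ?thesis unfolding weight_def 1 bracket_Suc 2 using assms by (simp add: algebra_simps)
qed

lemma weight_diff:
  assumes "2 * k + m \<le> M + 1"
  shows "weight M (k + m) - weight M k = real q ^ k * bracket m * bracket (M + 1 - 2 * k - m)"
proof -
  have q: "real q - 1 \<noteq> 0" using q_ge_2 by simp
  define n where "n = M + 1 - 2 * k - m"
  have e: "M + 1 - (k + m) = k + n" "M + 1 - k = k + m + n" using assms by (auto simp: n_def)
  have *: "(K * A - 1) / Q * ((K * B - 1) / Q) - (K - 1) / Q * ((K * A * B - 1) / Q)
      = K * ((A - 1) / Q) * ((B - 1) / Q)" if "Q \<noteq> 0" for K A B Q :: real
    using that by (simp add: divide_simps) (simp add: algebra_simps)
  show ?thesis
    unfolding weight_def e bracket_def n_def[symmetric] power_add by (rule *[OF q])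
qed

lemma weight_less:
  assumes "2 * k + m \<le> M" "0 < m"
  shows "weight M k < weight M (k + m)"
proof -
  have "0 < real q ^ k * bracket m * bracket (M + 1 - 2 * k - m)"
    using assms q_ge_2 by (intro mult_pos_pos bracket_pos) auto
  then show ?thesis using weight_diff[of k m M] assms by simp
qed

abbreviation upn :: "'v set \<Rightarrow> nat \<Rightarrow> complex ^ 'v set \<Rightarrow> complex ^ 'v set" where
  "upn T m \<equiv> ((*v) (up T)) ^^ m"

lemma upn_level_vecs: "c \<in> level_vecs T i \<Longrightarrow> upn T m c \<in> level_vecs T (i + m)"
  by (induction m) (auto intro: up_level_vecs)

lemma upn_0 [simp]: "upn T m 0 = 0"
  by (induction m) auto

lemma upn_smult: "upn T m (a *s c) = a *s upn T m c"
  by (induction m) (auto simp: matrix_vector_mult_smult)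

lemma down_upn:
  assumes "subspace T" "c \<in> level_vecs T k" "k + m \<le> dim T"
  shows "down T *v upn T (Suc m) c = upn T (Suc m) (down T *v c)
    + complex_of_real (weight (dim T) (k + Suc m) - weight (dim T) k) *s upn T m c"
  using assms(3)
proof (induction m)
  case 0
  then show ?case using down_up[OF assms(1,2)] by (simp add: weight_Suc)
next
  case (Suc m)
  have "down T *v upn T (Suc (Suc m)) c = down T *v (up T *v upn T (Suc m) c)" by simp
  also have "\<dots> = up T *v (down T *v upn T (Suc m) c)
      + complex_of_real (bracket (dim T - (k + Suc m)) - bracket (k + Suc m)) *s upn T (Suc m) c"
    by (rule down_up[OF assms(1) upn_level_vecs[OF assms(2)]])
  also have "up T *v (down T *v upn T (Suc m) c) = upn T (Suc (Suc m)) (down T *v c)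
    + complex_of_real (weight (dim T) (k + Suc m) - weight (dim T) k) *s upn T (Suc m) c"
    unfolding Suc.IH[OF Suc_leD[OF Suc.prems[unfolded add_Suc_right]]]
      matrix_vector_right_distrib matrix_vector_mult_smult by simp
  also have "upn T (Suc (Suc m)) (down T *v c)
      + complex_of_real (weight (dim T) (k + Suc m) - weight (dim T) k) *s upn T (Suc m) c
      + complex_of_real (bracket (dim T - (k + Suc m)) - bracket (k + Suc m)) *s upn T (Suc m) c
      = upn T (Suc (Suc m)) (down T *v c)
      + complex_of_real (weight (dim T) (k + Suc (Suc m)) - weight (dim T) k) *s upn T (Suc m) c"
  proof -
    have "weight (dim T) (k + Suc (Suc m)) - weight (dim T) k = weight (dim T) (k + Suc m) - weight (dim T) k
        + (bracket (dim T - (k + Suc m)) - bracket (k + Suc m))"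
      using weight_Suc[of "k + Suc m" "dim T"] Suc.prems by simp
    then show ?thesis by (simp only: of_real_add vec.scale_left_distrib add.assoc)
  qed
  finally show ?case .
qed

lemma upn_inj:
  assumes "subspace T" "c \<in> level_vecs T k" "2 * k + m \<le> dim T" "upn T m c = 0"
  shows "c = 0"
  using assms(2-4)
proof (induction k arbitrary: c m)
  case 0
  then show ?case
  proof (induction m)
    case (Suc m)
    have "down T *v c = 0" using Suc.prems down_level_vecs_0 by blast
    then have "complex_of_real (weight (dim T) (0 + Suc m) - weight (dim T) 0) *s upn T m c = 0"
      using down_upn[OF assms(1) Suc.prems(1), of m] Suc.prems by simp
    moreover have "weight (dim T) 0 < weight (dim T) (0 + Suc m)" using Suc.prems by (intro weight_less) auto
    ultimately have "upn T m c = 0" by simp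
    then show ?case using Suc by auto
  qed simp
next
  case (Suc k)
  note IH = Suc.IH
  from Suc.prems show ?case
  proof (induction m)
    case (Suc m)
    have *: "upn T (Suc m) (down T *v c)
        + complex_of_real (weight (dim T) (Suc k + Suc m) - weight (dim T) (Suc k)) *s upn T m c = 0"
      using down_upn[OF assms(1) Suc.prems(1), of m] Suc.prems by simp
    have "up T *v (upn T (Suc m) (down T *v c)
        + complex_of_real (weight (dim T) (Suc k + Suc m) - weight (dim T) (Suc k)) *s upn T m c) = 0"
      unfolding * by simp
    moreover have "up T *v upn T m c = 0" using Suc.prems(3) by simp
    ultimately have "upn T (Suc (Suc m)) (down T *v c) = 0"
      unfolding matrix_vector_right_distrib matrix_vector_mult_smult by simp
    then have "down T *v c = 0"
      using IH[OF down_level_vecs[OF Suc.prems(1)], of "Suc (Suc m)"] Suc.prems(2) by simp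
    then have "complex_of_real (weight (dim T) (Suc k + Suc m) - weight (dim T) (Suc k)) *s upn T m c = 0"
      using * by simp
    moreover have "weight (dim T) (Suc k) < weight (dim T) (Suc k + Suc m)"
      using Suc.prems by (intro weight_less) auto
    ultimately have "upn T m c = 0" by simp
    then show ?case using Suc by auto
  qed simp
qed

lemma hermitian_prod_up: "hermitian_prod (up T *v u) w = hermitian_prod u (down T *v w)"
  unfolding down_def by (rule hermitian_prod_transpose) (simp add: up_def)

end

section \<open>Eigenspaces of the Grassmann graph\<close>

lemma eigen_components_in_invariant_subspace:
  fixes M :: "complex ^ 'i::finite ^ 'i"
  assumes "vec.subspace W" "\<And>w. w \<in> W \<Longrightarrow> M *v w \<in> W"
    and "finite I" "inj_on \<theta> I" "\<And>i. i \<in> I \<Longrightarrow> M *v p i = \<theta> i *s p i"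
    and "(\<Sum>i\<in>I. p i) \<in> W" "i \<in> I"
  shows "p i \<in> W"
proof -
  have "\<forall>i\<in>I. p i \<in> W"
    using assms(3-6)
  proof (induction I arbitrary: p rule: finite_induct)
    case (insert j I)
    let ?S = "\<Sum>i\<in>insert j I. p i"
    have "M *v ?S - \<theta> j *s ?S = (\<Sum>i\<in>insert j I. (\<theta> i - \<theta> j) *s p i)"
      unfolding matrix_vector_mult_sum vec.scale_sum_right sum_subtractf[symmetric]
      by (rule sum.cong) (use insert.prems(2) in \<open>auto simp: vec.scale_left_diff_distrib\<close>)
    also have "\<dots> = (\<Sum>i\<in>I. (\<theta> i - \<theta> j) *s p i)"
      using insert.hyps by simp
    finally have "(\<Sum>i\<in>I. (\<theta> i - \<theta> j) *s p i) \<in> W"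
      using assms(1,2) insert.prems(3) by (metis vec.subspace_diff vec.subspace_scale)
    then have IH: "\<forall>i\<in>I. (\<theta> i - \<theta> j) *s p i \<in> W"
    proof (intro insert.IH)
      show "inj_on \<theta> I" using insert.prems(1) by (rule inj_on_subset) auto
      fix i assume "i \<in> I"
      then have "M *v p i = \<theta> i *s p i" using insert.prems(2) by blast
      then show "M *v ((\<theta> i - \<theta> j) *s p i) = \<theta> i *s ((\<theta> i - \<theta> j) *s p i)"
        by (simp only: matrix_vector_mult_smult vec.scale_scale mult.commute)
    qed
    have I: "p i \<in> W" if "i \<in> I" for i
    proof -
      have "\<theta> i - \<theta> j \<noteq> 0" using insert.prems(1) insert.hyps that by (auto simp: inj_on_def)
      then have "p i = inverse (\<theta> i - \<theta> j) *s ((\<theta> i - \<theta> j) *s p i)"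
        by (simp only: vec.scale_scale left_inverse vec.scale_one simp_thms)
      then show ?thesis using IH that assms(1) by (metis vec.subspace_scale)
    qed
    have "p j = ?S - (\<Sum>i\<in>I. p i)" using insert.hyps by simp
    moreover have "(\<Sum>i\<in>I. p i) \<in> W" using I assms(1) by (intro vec.subspace_sum) auto
    ultimately have "p j \<in> W" using insert.prems(3) assms(1) by (metis vec.subspace_diff)
    then show ?case using I by auto
  qed simp
  then show ?thesis using assms(7) by blast
qed

lemma subspace_supported_vecs: "vec.subspace (supported_vecs S)"
  unfolding vec.subspace_def supported_vecs_def by auto

lemma vec_eq_sum_axis: "v = (\<Sum>z\<in>UNIV. v $ z *s axis z 1)" for v :: "complex ^ 'i::finite"
  by (simp add: vec_eq_iff axis_def if_distrib cong: if_cong)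

lemma orth_proj_works:
  fixes S :: "'i::finite set"
  assumes U: "vec.subspace U" "U \<subseteq> supported_vecs S"
    and ex: "\<And>v. v \<in> supported_vecs S \<Longrightarrow> \<exists>p\<in>U. \<forall>w\<in>U. hermitian_prod (v - p) w = 0"
    and v: "v \<in> supported_vecs S"
  shows "orth_proj S U *v v \<in> U" "w \<in> U \<Longrightarrow> hermitian_prod (v - orth_proj S U *v v) w = 0"
proof -
  let ?Q = "\<lambda>M. M \<in> supported_mats S \<and>
     (\<forall>v\<in>supported_vecs S. M *v v \<in> U \<and> (\<forall>w\<in>U. hermitian_prod (v - M *v v) w = 0))"
  have axis: "axis z 1 \<in> supported_vecs S \<longleftrightarrow> z \<in> S" for z
    by (auto simp: supported_vecs_def axis_def)
  have "\<forall>z\<in>S. \<exists>p\<in>U. \<forall>w\<in>U. hermitian_prod (axis z 1 - p) w = 0"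
    using ex axis by blast
  then obtain p where p: "\<And>z. z \<in> S \<Longrightarrow> p z \<in> U"
    "\<And>z w. z \<in> S \<Longrightarrow> w \<in> U \<Longrightarrow> hermitian_prod (axis z 1 - p z) w = 0"
    by metis
  define M where "M = (\<chi> y z. if z \<in> S then p z $ y else 0)"
  have Mv: "M *v v = (\<Sum>z\<in>S. v $ z *s p z)" for v
    by (simp add: vec_eq_iff M_def matrix_vector_mult_def)
      (intro allI sum.mono_neutral_cong_right, auto)
  have Q_M: "?Q M"
  proof (intro conjI ballI)
    show "M \<in> supported_mats S"
      using p(1) U(2) unfolding supported_mats_def supported_vecs_def M_def by fastforce
    fix v assume v: "v \<in> supported_vecs S"
    show "M *v v \<in> U" unfolding Mv using p(1) U(1) by (intro vec.subspace_sum vec.subspace_scale) auto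
    fix w assume w: "w \<in> U"
    have "v = (\<Sum>z\<in>S. v $ z *s axis z 1)"
      using v unfolding supported_vecs_def
      by (subst (1) vec_eq_sum_axis) (auto intro!: sum.mono_neutral_right)
    then have "v - M *v v = (\<Sum>z\<in>S. v $ z *s (axis z 1 - p z))"
      unfolding Mv by (simp add: vec.scale_right_diff_distrib sum_subtractf)
    then show "hermitian_prod (v - M *v v) w = 0"
      using p(2) w by (simp add: hermitian_prod_sum hermitian_prod_simps)
  qed
  have uniq: "M' = M''" if Q: "?Q M'" "?Q M''" for M' M''
  proof -
    have eq: "M' *v v = M'' *v v" if v: "v \<in> supported_vecs S" for v
    proof -
      have d: "M' *v v - M'' *v v \<in> U" using Q v U(1) by (auto intro: vec.subspace_diff)
      have "M' *v v - M'' *v v = (v - M'' *v v) - (v - M' *v v)" by simp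
      then have "hermitian_prod (M' *v v - M'' *v v) (M' *v v - M'' *v v) = 0"
        using Q v d by (metis hermitian_prod_simps(3) diff_zero)
      then show ?thesis by (simp add: hermitian_prod_self_eq_0)
    qed
    show ?thesis
    proof (rule vec_eq_iff[THEN iffD2], intro allI, rule vec_eq_iff[THEN iffD2], intro allI)
      fix y z
      have col: "K $ y $ z = (K *v axis z 1) $ y" for K :: "complex ^ 'i ^ 'i"
        by (simp add: matrix_vector_mult_def axis_def if_distrib cong: if_cong)
      show "M' $ y $ z = M'' $ y $ z"
      proof (cases "z \<in> S")
        case True
        then show ?thesis unfolding col using eq axis by simp
      next
        case False
        then show ?thesis using Q unfolding supported_mats_def by auto
      qed
    qed
  qed
  have "\<exists>!M. ?Q M"
  proof (rule ex1I[of ?Q M])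
    show "?Q M" by (fact Q_M)
    show "M' = M" if "?Q M'" for M' using that Q_M by (rule uniq)
  qed
  then have "?Q (orth_proj S U)"
    unfolding orth_proj_def by (rule theI')
  then show "orth_proj S U *v v \<in> U" "w \<in> U \<Longrightarrow> hermitian_prod (v - orth_proj S U *v v) w = 0"
    using v by auto
qed

context grassmann
begin

declare fd.dim_UNIV [simp del] dim_UNIV [simp]

lemma down_upn_kernel:
  assumes "subspace T" "c \<in> level_vecs T k" "down T *v c = 0" "k + m \<le> dim T"
  shows "down T *v upn T (Suc m) c = complex_of_real (weight (dim T) (k + Suc m) - weight (dim T) k) *s upn T m c"
  using down_upn[OF assms(1,2,4)] unfolding assms(3) upn_0 by simp

lemma level_vecs_decomposition:
  assumes "subspace T" "c \<in> level_vecs T l" "2 * l \<le> dim T"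
  shows "\<exists>f. (\<forall>i\<le>l. f i \<in> level_vecs T i \<and> down T *v f i = 0) \<and> c = (\<Sum>i\<le>l. upn T (l - i) (f i))"
  using assms(2,3)
proof (induction l arbitrary: c)
  case 0
  then show ?case using down_level_vecs_0 by (intro exI[of _ "\<lambda>_. c"]) auto
next
  case (Suc l)
  obtain f where f: "\<And>i. i \<le> l \<Longrightarrow> f i \<in> level_vecs T i" "\<And>i. i \<le> l \<Longrightarrow> down T *v f i = 0"
    and dc: "down T *v c = (\<Sum>i\<le>l. upn T (l - i) (f i))"
    using Suc.IH[OF down_level_vecs[OF Suc.prems(1)]] Suc.prems(2) by auto
  define \<kappa> where "\<kappa> i = complex_of_real (weight (dim T) (Suc l) - weight (dim T) i)" for i
  define g where "g i = inverse (\<kappa> i) *s f i" for i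
  define c' where "c' = c - (\<Sum>i\<le>l. upn T (Suc l - i) (g i))"
  have \<kappa>: "\<kappa> i \<noteq> 0" if "i \<le> l" for i
    using weight_less[of i "Suc l - i" "dim T"] that Suc.prems(2) by (simp add: \<kappa>_def)
  have g: "g i \<in> level_vecs T i" "down T *v g i = 0" if "i \<le> l" for i
    using f that subspace_level_vecs by (auto simp: g_def vec.subspace_scale matrix_vector_mult_smult)
  have "down T *v upn T (Suc l - i) (g i) = upn T (l - i) (f i)" if i: "i \<le> l" for i
  proof -
    have "down T *v upn T (Suc (l - i)) (g i)
        = complex_of_real (weight (dim T) (i + Suc (l - i)) - weight (dim T) i) *s upn T (l - i) (g i)"
      using i Suc.prems(2) by (intro down_upn_kernel assms(1) g) auto
    also have "\<dots> = \<kappa> i *s upn T (l - i) (g i)" using i by (simp add: \<kappa>_def)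
    also have "\<dots> = upn T (l - i) (f i)" unfolding g_def upn_smult using \<kappa>[OF i] by simp
    finally show ?thesis using i by (simp add: Suc_diff_le)
  qed
  then have "down T *v c' = 0"
    unfolding c'_def matrix_vector_mult_diff_distrib matrix_vector_mult_sum dc by simp
  moreover have "c' \<in> level_vecs T (Suc l)"
  proof -
    have "upn T (Suc l - i) (g i) \<in> level_vecs T (Suc l)" if "i \<le> l" for i
      using upn_level_vecs[OF g(1)[OF that], of "Suc l - i"] that by simp
    then show ?thesis unfolding c'_def
      using Suc.prems(1) subspace_level_vecs by (intro vec.subspace_diff vec.subspace_sum) auto
  qed
  moreover have "c = (\<Sum>i\<le>Suc l. upn T (Suc l - i) (if i \<le> l then g i else c'))"
    by (simp add: c'_def)
  ultimately show ?case
    using g by (intro exI[of _ "\<lambda>i. if i \<le> l then g i else c'"]) (auto simp: le_Suc_eq)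
qed

lemma supported_vecs_vertices: "supported_vecs vertices = level_vecs UNIV D"
  unfolding supported_vecs_def vertices_def level_vecs_def by auto

lemma adjacent_iff_adj_in: "y \<in> vertices \<Longrightarrow> adjacent y z \<longleftrightarrow> z \<in> adj_in UNIV y"
  using D_ge_1 unfolding adjacent_def vertices_def adj_in_def by auto

lemma adjacency_eq_up_down:
  assumes "f \<in> level_vecs UNIV D"
  shows "adjacency_matrix *v f = up UNIV *v (down UNIV *v f) - complex_of_real (bracket D) *s f"
proof (rule vec_eq_iff[THEN iffD2], rule allI)
  fix y
  show "(adjacency_matrix *v f) $ y
    = (up UNIV *v (down UNIV *v f) - complex_of_real (bracket D) *s f) $ y"
  proof (cases "y \<in> vertices")
    case True
    then have y: "subspace y" "dim y = D" by (auto simp: vertices_def)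
    have "(adjacency_matrix *v f) $ y = (\<Sum>z\<in>UNIV. if z \<in> adj_in UNIV y then f $ z else 0)"
      unfolding adjacency_matrix_def matrix_vector_mult_def vec_lambda_beta
      using adjacent_iff_adj_in[OF True] by (intro sum.cong) auto
    also have "\<dots> = (\<Sum>z\<in>adj_in UNIV y. f $ z)" by (simp add: sum.If_cases)
    finally show ?thesis using y by (simp add: up_down_nth)
  next
    case False
    then have "f $ y = 0" using level_vecsD[OF assms] unfolding vertices_def by blast
    moreover have "(adjacency_matrix *v f) $ y = 0"
      using False unfolding adjacency_matrix_def matrix_vector_mult_def adjacent_def by simp
    moreover have "up UNIV *v (down UNIV *v f) \<in> level_vecs UNIV D"
    proof -
      have "f \<in> level_vecs UNIV (Suc (D - 1))" using assms D_ge_1 by simp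
      from up_level_vecs[OF down_level_vecs[OF this]] show ?thesis using D_ge_1 by simp
    qed
    then have "(up UNIV *v (down UNIV *v f)) $ y = 0"
      using False level_vecsD unfolding vertices_def by blast
    ultimately show ?thesis by simp
  qed
qed

lemma eigval_eq: "i \<le> N \<Longrightarrow> eigval i = weight N D - weight N i - bracket D"
proof -
  assume i: "i \<le> N"
  have q: "real q - 1 \<noteq> 0" using q_ge_2 by simp
  have "bracket (N + 1 - D) = real q * bracket (N - D) + 1"
    using N_gt q by (simp add: bracket_def field_simps Suc_diff_le)
  moreover have "N + 1 - i = N - i + 1" using i by simp
  ultimately show ?thesis unfolding eigval_def weight_def by (simp add: algebra_simps)
qed

lemma eigval_strict_antimono: "i < j \<Longrightarrow> j \<le> D \<Longrightarrow> eigval j < eigval i"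
  using weight_less[of i "j - i" N] N_gt by (simp add: eigval_eq)

lemma eigval_inj: "inj_on (\<lambda>i. complex_of_real (eigval i)) {..D}"
  by (rule inj_onI) (metis atMost_iff eigval_strict_antimono linorder_neqE_nat of_real_eq_iff order_less_irrefl)

definition eigspace :: "nat \<Rightarrow> (complex ^ 'v set) set" where
  "eigspace i = {v \<in> level_vecs UNIV D. adjacency_matrix *v v = complex_of_real (eigval i) *s v}"

lemma subspace_eigspace: "vec.subspace (eigspace i)"
proof (rule vec.subspaceI)
  show "0 \<in> eigspace i" unfolding eigspace_def using vec.subspace_0[OF subspace_level_vecs] by simp
next
  fix u v assume "u \<in> eigspace i" "v \<in> eigspace i"
  then show "u + v \<in> eigspace i"
    unfolding eigspace_def
    by (auto simp: matrix_vector_right_distrib vec.scale_right_distrib vec.subspace_add[OF subspace_level_vecs])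
next
  fix c u assume "u \<in> eigspace i"
  then show "c *s u \<in> eigspace i"
    unfolding eigspace_def
    by (auto simp: matrix_vector_mult_smult vec.subspace_scale[OF subspace_level_vecs])
qed

lemma upn_kernel_eigspace:
  assumes "f \<in> level_vecs UNIV i" "down UNIV *v f = 0" "i \<le> D"
  shows "upn UNIV (D - i) f \<in> eigspace i"
proof -
  have L: "upn UNIV (D - i) f \<in> level_vecs UNIV D" using upn_level_vecs[OF assms(1), of "D - i"] assms(3) by simp
  have "up UNIV *v (down UNIV *v upn UNIV (D - i) f)
      = complex_of_real (weight N D - weight N i) *s upn UNIV (D - i) f"
  proof (cases "i = D")
    case True
    then show ?thesis using assms by simp
  next
    case False
    then obtain m where m: "D - i = Suc m" using assms(3) by (cases "D - i") auto
    have "down UNIV *v upn UNIV (Suc m) f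
        = complex_of_real (weight N (i + Suc m) - weight N i) *s upn UNIV m f"
      using down_upn_kernel[of UNIV f i m] assms m N_gt by (simp add: dim_UNIV)
    then have "up UNIV *v (down UNIV *v upn UNIV (Suc m) f)
        = complex_of_real (weight N (i + Suc m) - weight N i) *s upn UNIV (Suc m) f"
      by (simp only: matrix_vector_mult_smult funpow.simps o_apply)
    moreover have "i + Suc m = D" using m by simp
    ultimately show ?thesis using m by simp
  qed
  then have "adjacency_matrix *v upn UNIV (D - i) f
      = complex_of_real (weight N D - weight N i) *s upn UNIV (D - i) f - complex_of_real (bracket D) *s upn UNIV (D - i) f"
    using adjacency_eq_up_down[OF L] by simp
  also have "\<dots> = complex_of_real (eigval i) *s upn UNIV (D - i) f"
    using assms(3) N_gt by (simp add: eigval_eq vec.scale_left_diff_distrib)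
  finally show ?thesis using L unfolding eigspace_def by simp
qed

lemma eigspace_orthogonal:
  assumes "u \<in> eigspace i" "w \<in> eigspace j" "i \<noteq> j" "i \<le> D" "j \<le> D"
  shows "hermitian_prod u w = 0"
proof -
  have "transpose adjacency_matrix = adjacency_matrix"
    unfolding transpose_def adjacency_matrix_def adjacent_def by (auto simp: vec_eq_iff Int_commute)
  then have "hermitian_prod (adjacency_matrix *v u) w = hermitian_prod u (adjacency_matrix *v w)"
    using hermitian_prod_transpose[of adjacency_matrix u w] unfolding adjacency_matrix_def by simp
  then have "complex_of_real (eigval i) * hermitian_prod u w = complex_of_real (eigval j) * hermitian_prod u w"
    using assms(1,2) unfolding eigspace_def by (simp add: hermitian_prod_simps)
  moreover have "eigval i \<noteq> eigval j"
    using assms eigval_strict_antimono by (metis linorder_neqE_nat order_less_irrefl)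
  ultimately show ?thesis by simp
qed

lemma eigspace_decomposition:
  assumes "w \<in> level_vecs UNIV D"
  shows "\<exists>f. (\<forall>i\<le>D. f i \<in> level_vecs UNIV i \<and> upn UNIV (D - i) (f i) \<in> eigspace i)
    \<and> w = (\<Sum>i\<le>D. upn UNIV (D - i) (f i))"
proof -
  obtain f where f: "\<forall>i\<le>D. f i \<in> level_vecs UNIV i \<and> down UNIV *v f i = 0"
    "w = (\<Sum>i\<le>D. upn UNIV (D - i) (f i))"
    using level_vecs_decomposition[OF subspace_UNIV assms] N_gt by auto
  have "\<forall>i\<le>D. f i \<in> level_vecs UNIV i \<and> upn UNIV (D - i) (f i) \<in> eigspace i"
    using f(1) upn_kernel_eigspace by blast
  then show ?thesis using f(2) by (intro exI[of _ f]) simp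
qed

lemma E_sum_eigspace:
  assumes p: "\<And>i. i \<le> D \<Longrightarrow> p i \<in> eigspace i" and "i \<le> D"
  shows "E i *v (\<Sum>i\<le>D. p i) = p i"
proof -
  have orth: "hermitian_prod ((\<Sum>i\<le>D. p i) - p i) w = 0"
    if p: "\<And>i. i \<le> D \<Longrightarrow> p i \<in> eigspace i" and w: "w \<in> eigspace i" for p w
  proof -
    have "(\<Sum>i\<le>D. p i) - p i = (\<Sum>j\<in>{..D} - {i}. p j)"
      using assms(2) by (simp add: sum_diff1)
    moreover have "hermitian_prod (p j) w = 0" if "j \<in> {..D} - {i}" for j
      using eigspace_orthogonal[OF p w] that assms(2) by auto
    ultimately show ?thesis by (simp add: hermitian_prod_sum)
  qed
  have level_vecs: "eigspace i \<subseteq> supported_vecs vertices"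
    unfolding supported_vecs_vertices eigspace_def by auto
  have ex: "\<exists>p\<in>eigspace i. \<forall>w\<in>eigspace i. hermitian_prod (v - p) w = 0"
    if v: "v \<in> supported_vecs vertices" for v
  proof -
    have "v \<in> level_vecs UNIV D" using v unfolding supported_vecs_vertices .
    from eigspace_decomposition[OF this]
    obtain f where f': "\<forall>j\<le>D. f j \<in> level_vecs UNIV j \<and> upn UNIV (D - j) (f j) \<in> eigspace j"
      and v_eq: "v = (\<Sum>j\<le>D. upn UNIV (D - j) (f j))"
      by auto
    have f: "upn UNIV (D - j) (f j) \<in> eigspace j" if "j \<le> D" for j using f' that by blast
    have "\<forall>w\<in>eigspace i. hermitian_prod (v - upn UNIV (D - i) (f i)) w = 0"
      unfolding v_eq using orth[of "\<lambda>j. upn UNIV (D - j) (f j)", OF f] by blast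
    then show ?thesis using f[OF assms(2)] by blast
  qed
  have S: "(\<Sum>i\<le>D. p i) \<in> supported_vecs vertices"
    unfolding supported_vecs_vertices
    using p subspace_level_vecs by (intro vec.subspace_sum) (auto simp: eigspace_def)
  have E: "E i = orth_proj vertices (eigspace i)"
    unfolding E_def eigspace_def supported_vecs_vertices by simp
  let ?d = "E i *v (\<Sum>i\<le>D. p i) - p i"
  have d: "?d \<in> eigspace i"
    unfolding E using orth_proj_works(1)[OF subspace_eigspace level_vecs ex S] p assms(2) subspace_eigspace
    by (auto intro: vec.subspace_diff)
  have eq: "((\<Sum>i\<le>D. p i) - p i) - ((\<Sum>i\<le>D. p i) - E i *v (\<Sum>i\<le>D. p i)) = ?d" by simp
  have 1: "hermitian_prod ((\<Sum>i\<le>D. p i) - p i) ?d = 0" using p d by (rule orth)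
  have 2: "hermitian_prod ((\<Sum>i\<le>D. p i) - E i *v (\<Sum>i\<le>D. p i)) ?d = 0"
    using orth_proj_works(2)[OF subspace_eigspace level_vecs ex S d] unfolding E .
  have "hermitian_prod (((\<Sum>i\<le>D. p i) - p i)
      - ((\<Sum>i\<le>D. p i) - E i *v (\<Sum>i\<le>D. p i))) ?d = 0"
    by (subst hermitian_prod_simps(3)) (simp only: 1 2 diff_self)
  then have "hermitian_prod ?d ?d = 0" unfolding eq .
  then show ?thesis by (simp add: hermitian_prod_self_eq_0)
qed

end

section \<open>Functions of the intersection with the base vertex\<close>

lemma diag_on_nth: "(diag_on S f *v v) $ u = (if u \<in> S then f u * v $ u else 0)"
proof -
  have "(diag_on S f *v v) $ u = (\<Sum>w\<in>UNIV. if w = u then (if u \<in> S then f u * v $ u else 0) else 0)"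
    unfolding diag_on_def matrix_vector_mult_def vec_lambda_beta by (rule sum.cong) auto
  then show ?thesis by simp
qed

context grassmann
begin

lemma ssum_commute: "S \<oplus>s T = T \<oplus>s S"
  unfolding ssum_def using add.commute by blast

definition slash_cov :: "'v set \<Rightarrow> 'v set set" where
  "slash_cov w = {v \<in> cov UNIV w. dim (v \<inter> x) = Suc (dim (w \<inter> x))}"

definition backslash_cov :: "'v set \<Rightarrow> 'v set set" where
  "backslash_cov w = {v \<in> cov UNIV w. dim (v \<inter> x) = dim (w \<inter> x)}"

definition slash_hyp :: "'v set \<Rightarrow> 'v set set" where
  "slash_hyp v = {h \<in> hyp v. dim (v \<inter> x) = Suc (dim (h \<inter> x))}"

definition backslash_hyp :: "'v set \<Rightarrow> 'v set set" where
  "backslash_hyp v = {h \<in> hyp v. dim (v \<inter> x) = dim (h \<inter> x)}"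

lemma subspace_Int_x: "subspace w \<Longrightarrow> subspace (w \<inter> x)"
  using subspace_x subspace_inter by blast

lemma P_part_iff: "w \<in> P_part i j \<longleftrightarrow> subspace w \<and> dim (w \<inter> x) = i \<and> dim w = i + j"
  unfolding P_part_def P_def by blast

lemma dim_Int_x_le: "dim (w \<inter> x) \<le> D" "dim (w \<inter> x) \<le> dim w"
  using dim_mono[of "w \<inter> x" x] dim_mono[of "w \<inter> x" w] dim_x by auto

lemma P_partD:
  assumes "w \<in> P_part i j"
  shows "i \<le> D" "j \<le> N - D"
proof -
  have w: "subspace w" "dim (w \<inter> x) = i" "dim w = i + j" using assms P_part_iff by auto
  show "i \<le> D" using dim_Int_x_le(1)[of w] w by simp
  have "dim (w \<oplus>s x) + i = i + j + D"
    using dim_ssum[OF w(1) subspace_x] w dim_x by simp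
  then show "j \<le> N - D" using dim_le_N[of "w \<oplus>s x"] by simp
qed

lemma P_part_exists:
  assumes "subspace u" "u \<subseteq> x" "dim u = i" "j \<le> N - D"
  shows "\<exists>w\<in>P_part i j. w \<inter> x = u"
proof -
  have "u \<oplus>s x = x" using ssum_absorb assms subspace_x by blast
  then have "dim (u \<oplus>s x) + j \<le> dim UNIV" using assms(4) N_gt dim_x by simp
  from exists_extension[OF assms(1) subspace_x subspace_UNIV _ _ this]
  obtain w where "subspace w" "w \<inter> x = u \<inter> x" "dim w = dim u + j" by auto
  moreover have "u \<inter> x = u" using assms(2) by blast
  ultimately show ?thesis using assms(3) by (intro bexI[of _ w]) (auto simp: P_part_iff)
qed

lemma cov_dim_Int_x:
  assumes "subspace w" "v \<in> cov UNIV w"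
  shows "dim (v \<inter> x) = dim (w \<inter> x) \<or> dim (v \<inter> x) = Suc (dim (w \<inter> x))"
proof -
  have v: "subspace v" "w \<subseteq> v" "dim v = Suc (dim w)" using assms(2) unfolding cov_def by auto
  have "dim (w \<inter> x) \<le> dim (v \<inter> x)" using v by (intro dim_mono) auto
  moreover have "dim ((v \<inter> x) \<oplus>s w) + dim (w \<inter> x) = dim (v \<inter> x) + dim w"
  proof -
    have "v \<inter> x \<inter> w = w \<inter> x" using v by auto
    then show ?thesis using dim_ssum[OF subspace_Int_x[OF v(1)] assms(1)] by simp
  qed
  moreover have "dim ((v \<inter> x) \<oplus>s w) \<le> dim v"
    using v by (intro dim_mono ssum_least) auto
  ultimately show ?thesis using v(3) by linarith
qed

lemma cov_split:
  assumes "subspace w"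
  shows "cov UNIV w = slash_cov w \<union> backslash_cov w" "slash_cov w \<inter> backslash_cov w = {}"
  using cov_dim_Int_x[OF assms] unfolding slash_cov_def backslash_cov_def by auto

lemma hyp_split:
  assumes "subspace v"
  shows "hyp v = slash_hyp v \<union> backslash_hyp v" "slash_hyp v \<inter> backslash_hyp v = {}"
proof -
  have "dim (v \<inter> x) = dim (h \<inter> x) \<or> dim (v \<inter> x) = Suc (dim (h \<inter> x))" if "h \<in> hyp v" for h
    using that cov_dim_Int_x[of h v] assms unfolding hyp_def cov_def by blast
  then show "hyp v = slash_hyp v \<union> backslash_hyp v" "slash_hyp v \<inter> backslash_hyp v = {}"
    unfolding slash_hyp_def backslash_hyp_def by auto
qed

lemma slash_covers_iff: "slash_covers v u \<longleftrightarrow> subspace u \<and> v \<in> slash_cov u"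
proof
  assume "slash_covers v u"
  then show "subspace u \<and> v \<in> slash_cov u"
    unfolding slash_covers_def slash_cov_def cov_def P_part_iff by auto
next
  assume a: "subspace u \<and> v \<in> slash_cov u"
  then have v: "subspace v" "u \<subseteq> v" "dim v = Suc (dim u)" "dim (v \<inter> x) = Suc (dim (u \<inter> x))"
    unfolding slash_cov_def cov_def by auto
  have "u \<in> P_part (dim (u \<inter> x)) (dim u - dim (u \<inter> x))"
    using a dim_Int_x_le(2)[of u] by (simp add: P_part_iff)
  moreover have "v \<in> P_part (dim (u \<inter> x) + 1) (dim u - dim (u \<inter> x))"
    using v dim_Int_x_le(2)[of u] by (simp add: P_part_iff)
  ultimately show "slash_covers v u" unfolding slash_covers_def using v by auto
qed

lemma backslash_covers_iff: "backslash_covers v u \<longleftrightarrow> subspace u \<and> v \<in> backslash_cov u"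
proof
  assume "backslash_covers v u"
  then show "subspace u \<and> v \<in> backslash_cov u"
    unfolding backslash_covers_def backslash_cov_def cov_def P_part_iff by auto
next
  assume a: "subspace u \<and> v \<in> backslash_cov u"
  then have v: "subspace v" "u \<subseteq> v" "dim v = Suc (dim u)" "dim (v \<inter> x) = dim (u \<inter> x)"
    unfolding backslash_cov_def cov_def by auto
  have "u \<in> P_part (dim (u \<inter> x)) (dim u - dim (u \<inter> x))"
    using a dim_Int_x_le(2)[of u] by (simp add: P_part_iff)
  moreover have "v \<in> P_part (dim (u \<inter> x)) (dim u - dim (u \<inter> x) + 1)"
    using v dim_Int_x_le(2)[of u] by (simp add: P_part_iff)
  ultimately show "backslash_covers v u" unfolding backslash_covers_def using v by auto
qed

lemma sum_indicator_matrix: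
  fixes f :: "complex ^ 'v set"
  assumes "\<And>v. M $ w $ v = (if v \<in> S then 1 else 0)"
  shows "(M *v f) $ w = (\<Sum>v\<in>S. f $ v)"
proof -
  have "(M *v f) $ w = (\<Sum>v\<in>UNIV. if v \<in> S then f $ v else 0)"
    unfolding matrix_vector_mult_def vec_lambda_beta assms by (rule sum.cong) auto
  then show ?thesis by (simp add: sum.If_cases)
qed

lemma L1_nth: "(L1 *v f) $ w = (if subspace w then \<Sum>v\<in>slash_cov w. f $ v else 0)"
  using sum_indicator_matrix[of L1 w "if subspace w then slash_cov w else {}" f]
  by (simp add: L1_def slash_covers_iff)

lemma L2_nth: "(L2 *v f) $ w = (if subspace w then \<Sum>v\<in>backslash_cov w. f $ v else 0)"
  using sum_indicator_matrix[of L2 w "if subspace w then backslash_cov w else {}" f]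
  by (simp add: L2_def backslash_covers_iff)

lemma R1_nth: "(R1 *v f) $ v = (if subspace v then \<Sum>h\<in>slash_hyp v. f $ h else 0)"
proof -
  have "R1 $ v $ h = (if h \<in> (if subspace v then slash_hyp v else {}) then 1 else 0)" for h
    unfolding R1_def L1_def transpose_def vec_lambda_beta slash_covers_iff slash_cov_def
      slash_hyp_def hyp_def cov_def by auto
  from sum_indicator_matrix[OF this, of f] show ?thesis by simp
qed

lemma R2_nth: "(R2 *v f) $ v = (if subspace v then \<Sum>h\<in>backslash_hyp v. f $ h else 0)"
proof -
  have "R2 $ v $ h = (if h \<in> (if subspace v then backslash_hyp v else {}) then 1 else 0)" for h
    unfolding R2_def L2_def transpose_def vec_lambda_beta backslash_covers_iff backslash_cov_def
      backslash_hyp_def hyp_def cov_def by auto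
  from sum_indicator_matrix[OF this, of f] show ?thesis by simp
qed

lemma down_UNIV: "down UNIV *v f = L1 *v f + L2 *v f"
proof (rule vec_eq_iff[THEN iffD2], rule allI)
  fix w show "(down UNIV *v f) $ w = (L1 *v f + L2 *v f) $ w"
    using cov_split[of w] by (simp add: down_nth L1_nth L2_nth sum.union_disjoint)
qed

lemma up_UNIV: "up UNIV *v f = R1 *v f + R2 *v f"
proof (rule vec_eq_iff[THEN iffD2], rule allI)
  fix w show "(up UNIV *v f) $ w = (R1 *v f + R2 *v f) $ w"
    using hyp_split[of w] by (simp add: up_nth R1_nth R2_nth sum.union_disjoint)
qed

lemma slash_cov_bij:
  assumes "subspace w"
  shows "(\<Sum>v\<in>slash_cov w. f (v \<inter> x)) = (\<Sum>u\<in>cov x (w \<inter> x). f u)"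
proof (rule sum.reindex_bij_witness[where i = "\<lambda>u. w \<oplus>s u" and j = "\<lambda>v. v \<inter> x"], goal_cases)
  case (1 v)
  then have v: "subspace v" "w \<subseteq> v" "dim v = Suc (dim w)" "dim (v \<inter> x) = Suc (dim (w \<inter> x))"
    unfolding slash_cov_def cov_def by auto
  have sv: "subspace (v \<inter> x)" using v subspace_Int_x by blast
  have le: "w \<oplus>s (v \<inter> x) \<subseteq> v" using v by (intro ssum_least) auto
  have "w \<inter> (v \<inter> x) = w \<inter> x" using v by auto
  then have "dim (w \<oplus>s (v \<inter> x)) = Suc (dim w)"
    using dim_ssum[OF assms sv] v by simp
  then show ?case using dim_eqD[OF subspace_ssum[OF assms sv] v(1) le] v(3) by simp
next
  case (2 v)
  then have v: "subspace v" "w \<subseteq> v" "dim (v \<inter> x) = Suc (dim (w \<inter> x))"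
    unfolding slash_cov_def cov_def by auto
  then show ?case using subspace_Int_x[of v] unfolding cov_def by auto
next
  case (3 u)
  then have u: "subspace u" "w \<inter> x \<subseteq> u" "u \<subseteq> x" unfolding cov_def by auto
  have "(w \<oplus>s u) \<inter> x = u \<oplus>s (w \<inter> x)"
    using modular_law[OF subspace_x u(3), of w] ssum_commute[of u w] by simp
  also have "\<dots> = u" using ssum_absorb[OF subspace_Int_x[OF assms] u(1,2)] ssum_commute by simp
  finally show ?case .
next
  case (4 u)
  then have u: "subspace u" "w \<inter> x \<subseteq> u" "u \<subseteq> x" "dim u = Suc (dim (w \<inter> x))"
    unfolding cov_def by auto
  have "(w \<oplus>s u) \<inter> x = u \<oplus>s (w \<inter> x)"
    using modular_law[OF subspace_x u(3), of w] ssum_commute[of u w] by simp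
  also have "\<dots> = u" using ssum_absorb[OF subspace_Int_x[OF assms] u(1,2)] ssum_commute by simp
  finally have *: "(w \<oplus>s u) \<inter> x = u" .
  have "w \<inter> u = w \<inter> x" using u by auto
  then have "dim (w \<oplus>s u) = Suc (dim w)" using dim_ssum[OF assms u(1)] u(4) by simp
  then show ?case
    unfolding slash_cov_def cov_def
    using * u(4) subspace_ssum[OF assms u(1)] ssum_upper1[OF u(1), of w] by simp
qed simp

lemma card_slash_cov:
  assumes "subspace w"
  shows "real (card (slash_cov w)) = bracket (D - dim (w \<inter> x))"
proof -
  have "real (card (slash_cov w)) = real (card (cov x (w \<inter> x)))"
    using slash_cov_bij[OF assms, of "\<lambda>_. 1 :: real"] by simp
  then show ?thesis using card_cov[OF subspace_Int_x[OF assms] subspace_x] dim_x by simp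
qed

lemma card_backslash_cov:
  assumes "subspace w"
  shows "real (card (backslash_cov w)) = bracket (N - dim w) - bracket (D - dim (w \<inter> x))"
proof -
  have "card (cov UNIV w) = card (slash_cov w) + card (backslash_cov w)"
    unfolding cov_split(1)[OF assms] using cov_split(2)[OF assms] by (intro card_Un_disjoint) auto
  then show ?thesis
    using card_slash_cov[OF assms] card_cov[OF assms subspace_UNIV] by simp
qed

definition lift :: "nat \<Rightarrow> nat \<Rightarrow> complex ^ 'v set \<Rightarrow> complex ^ 'v set" where
  "lift i j g = (\<chi> w. if w \<in> P_part i j then g $ (w \<inter> x) else 0)"

lemma lift_nth: "lift i j g $ w = (if w \<in> P_part i j then g $ (w \<inter> x) else 0)"
  by (simp add: lift_def)

lemma lift_add: "lift i j (g + g') = lift i j g + lift i j g'"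
  by (simp add: vec_eq_iff lift_nth)

lemma lift_smult: "lift i j (c *s g) = c *s lift i j g"
  by (simp add: vec_eq_iff lift_nth)

lemma lift_0 [simp]: "lift i j 0 = 0"
  by (simp add: vec_eq_iff lift_nth)

lemma lift_outside: "\<not> (i \<le> D \<and> j \<le> N - D) \<Longrightarrow> lift i j g = 0"
  using P_partD by (auto simp: vec_eq_iff lift_nth)

lemma lift_eq_0D:
  assumes "g \<in> level_vecs x i" "j \<le> N - D" "lift i j g = 0"
  shows "g = 0"
proof (rule ccontr)
  assume "g \<noteq> 0"
  then obtain u where u: "g $ u \<noteq> 0" by (auto simp: vec_eq_iff)
  then obtain w where "w \<in> P_part i j" "w \<inter> x = u"
    using level_vecsD[OF assms(1)] P_part_exists[OF _ _ _ assms(2)] by metis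
  then have "lift i j g $ w = g $ u" by (simp add: lift_nth)
  then show False using u assms(3) by simp
qed

lemma lift_restrict: "\<exists>g'\<in>level_vecs x i. lift i j g = lift i j g'"
proof
  let ?g = "\<chi> u. if subspace u \<and> u \<subseteq> x \<and> dim u = i then g $ u else 0"
  show "?g \<in> level_vecs x i" unfolding level_vecs_def by simp
  show "lift i j g = lift i j ?g"
    using subspace_Int_x by (auto simp: vec_eq_iff lift_nth P_part_iff)
qed

lemma L1_lift: "L1 *v lift (Suc i) j g = lift i j (down x *v g)"
proof (rule vec_eq_iff[THEN iffD2], rule allI)
  fix w
  show "(L1 *v lift (Suc i) j g) $ w = lift i j (down x *v g) $ w"
  proof (cases "subspace w")
    case True
    have iff: "v \<in> P_part (Suc i) j \<longleftrightarrow> w \<in> P_part i j" if "v \<in> slash_cov w" for v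
      using that True unfolding slash_cov_def cov_def P_part_iff by auto
    have "(L1 *v lift (Suc i) j g) $ w = (\<Sum>v\<in>slash_cov w. if w \<in> P_part i j then g $ (v \<inter> x) else 0)"
      using True iff by (auto simp: L1_nth lift_nth intro!: sum.cong)
    also have "\<dots> = (if w \<in> P_part i j then \<Sum>v\<in>slash_cov w. g $ (v \<inter> x) else 0)" by simp
    also have "(\<Sum>v\<in>slash_cov w. g $ (v \<inter> x)) = (down x *v g) $ (w \<inter> x)"
      using slash_cov_bij[OF True] subspace_Int_x[OF True] by (simp add: down_nth)
    finally show ?thesis by (simp add: lift_nth)
  qed (simp add: L1_nth lift_nth P_part_iff)
qed

lemma L1_lift_0: "L1 *v lift 0 j g = 0"
proof (rule vec_eq_iff[THEN iffD2], rule allI)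
  fix w
  have "lift 0 j g $ v = 0" if "v \<in> slash_cov w" for v
    using that unfolding slash_cov_def by (auto simp: lift_nth P_part_iff)
  then show "(L1 *v lift 0 j g) $ w = 0 $ w" by (simp add: L1_nth)
qed

lemma L2_lift:
  "L2 *v lift i (Suc j) g = complex_of_real (bracket (N - (i + j)) - bracket (D - i)) *s lift i j g"
proof (rule vec_eq_iff[THEN iffD2], rule allI)
  fix w
  show "(L2 *v lift i (Suc j) g) $ w
    = (complex_of_real (bracket (N - (i + j)) - bracket (D - i)) *s lift i j g) $ w"
  proof (cases "subspace w")
    case True
    have iff: "v \<in> P_part i (Suc j) \<longleftrightarrow> w \<in> P_part i j" "v \<inter> x = w \<inter> x" if "v \<in> backslash_cov w" for v
    proof -
      have v: "subspace v" "w \<subseteq> v" "dim v = Suc (dim w)" "dim (v \<inter> x) = dim (w \<inter> x)"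
        using that unfolding backslash_cov_def cov_def by auto
      then show "v \<in> P_part i (Suc j) \<longleftrightarrow> w \<in> P_part i j" using True unfolding P_part_iff by auto
      have "w \<inter> x = v \<inter> x"
        by (rule dim_eqD[OF subspace_Int_x[OF True] subspace_Int_x[OF v(1)]]) (use v in auto)
      then show "v \<inter> x = w \<inter> x" by simp
    qed
    have "(L2 *v lift i (Suc j) g) $ w = (\<Sum>v\<in>backslash_cov w. lift i j g $ w)"
      using True iff by (auto simp: L2_nth lift_nth intro!: sum.cong)
    also have "\<dots> = complex_of_real (real (card (backslash_cov w))) * lift i j g $ w" by simp
    also have "\<dots> = complex_of_real (bracket (N - (i + j)) - bracket (D - i)) * lift i j g $ w"
      unfolding card_backslash_cov[OF True] by (simp add: lift_nth P_part_iff)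
    finally show ?thesis by (simp add: algebra_simps)
  qed (simp add: L2_nth lift_nth P_part_iff)
qed

lemma L2_lift_0: "L2 *v lift i 0 g = 0"
proof (rule vec_eq_iff[THEN iffD2], rule allI)
  fix w
  have "lift i 0 g $ v = 0" if "v \<in> backslash_cov w" for v
    using that dim_Int_x_le(2)[of w] unfolding backslash_cov_def cov_def
    by (auto simp: lift_nth P_part_iff)
  then show "(L2 *v lift i 0 g) $ w = 0 $ w" by (simp add: L2_nth)
qed

lemma R2_lift: "R2 *v lift i j g = complex_of_real (bracket (Suc j)) *s lift i (Suc j) g"
proof (rule vec_eq_iff[THEN iffD2], rule allI)
  fix v
  show "(R2 *v lift i j g) $ v = (complex_of_real (bracket (Suc j)) *s lift i (Suc j) g) $ v"
  proof (cases "subspace v")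
    case True
    have iff: "h \<in> P_part i j \<longleftrightarrow> v \<in> P_part i (Suc j)" "h \<inter> x = v \<inter> x" if "h \<in> backslash_hyp v" for h
    proof -
      have h: "subspace h" "h \<subseteq> v" "dim v = Suc (dim h)" "dim (v \<inter> x) = dim (h \<inter> x)"
        using that unfolding backslash_hyp_def hyp_def by auto
      then show "h \<in> P_part i j \<longleftrightarrow> v \<in> P_part i (Suc j)" using True unfolding P_part_iff by auto
      show "h \<inter> x = v \<inter> x"
        by (rule dim_eqD[OF subspace_Int_x[OF h(1)] subspace_Int_x[OF True]]) (use h in auto)
    qed
    have "(R2 *v lift i j g) $ v = (\<Sum>h\<in>backslash_hyp v. lift i (Suc j) g $ v)"
      using True iff by (auto simp: R2_nth lift_nth intro!: sum.cong)
    also have "\<dots> = complex_of_real (real (card (backslash_hyp v))) * lift i (Suc j) g $ v" by simp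
    also have "backslash_hyp v = {h \<in> hyp v. v \<inter> x \<subseteq> h}"
    proof (intro set_eqI iffI)
      fix h assume "h \<in> backslash_hyp v"
      then show "h \<in> {h \<in> hyp v. v \<inter> x \<subseteq> h}" using iff(2)[of h] unfolding backslash_hyp_def by auto
    next
      fix h assume h: "h \<in> {h \<in> hyp v. v \<inter> x \<subseteq> h}"
      then have "h \<inter> x = v \<inter> x" unfolding hyp_def by auto
      then show "h \<in> backslash_hyp v" using h unfolding backslash_hyp_def by auto
    qed
    also have "real (card {h \<in> hyp v. v \<inter> x \<subseteq> h}) = bracket (dim v - dim (v \<inter> x))"
      using card_hyp_above[OF subspace_Int_x[OF True] True] by auto
    also have "complex_of_real (bracket (dim v - dim (v \<inter> x))) * lift i (Suc j) g $ v
        = complex_of_real (bracket (Suc j)) * lift i (Suc j) g $ v"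
      by (simp add: lift_nth P_part_iff)
    finally show ?thesis by simp
  qed (simp add: R2_nth lift_nth P_part_iff)
qed

lemma card_slash_hyp_fibre:
  assumes v: "subspace v" and u: "u \<in> hyp (v \<inter> x)"
  shows "real (card {h \<in> slash_hyp v. h \<inter> x = u}) = real q ^ (dim v - dim (v \<inter> x))"
proof -
  have u': "subspace u" "u \<subseteq> v \<inter> x" "dim (v \<inter> x) = Suc (dim u)" using u unfolding hyp_def by auto
  have eq: "{h \<in> slash_hyp v. h \<inter> x = u} = {h \<in> hyp v. u \<subseteq> h} - {h \<in> hyp v. v \<inter> x \<subseteq> h}"
  proof (intro set_eqI iffI)
    fix h assume "h \<in> {h \<in> slash_hyp v. h \<inter> x = u}"
    then have h: "h \<in> hyp v" "h \<inter> x = u" unfolding slash_hyp_def by auto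
    have "\<not> v \<inter> x \<subseteq> h"
    proof
      assume "v \<inter> x \<subseteq> h"
      then have "v \<inter> x \<subseteq> u" using h by auto
      then show False using dim_mono[of "v \<inter> x" u] u'(3) by simp
    qed
    then show "h \<in> {h \<in> hyp v. u \<subseteq> h} - {h \<in> hyp v. v \<inter> x \<subseteq> h}" using h by auto
  next
    fix h assume "h \<in> {h \<in> hyp v. u \<subseteq> h} - {h \<in> hyp v. v \<inter> x \<subseteq> h}"
    then have h: "h \<in> hyp v" "u \<subseteq> h" "\<not> v \<inter> x \<subseteq> h" "subspace h" "h \<subseteq> v" unfolding hyp_def by auto
    have sub: "subspace (h \<inter> x)" "subspace (v \<inter> x)" using h(4) v subspace_Int_x by auto
    have "h \<inter> x \<subset> v \<inter> x" using h by auto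
    then have "dim (h \<inter> x) < dim (v \<inter> x)" using dim_less[OF sub] by blast
    then have "u = h \<inter> x" using u' h by (intro dim_eqD[OF u'(1) sub(1)]) auto
    then show "h \<in> {h \<in> slash_hyp v. h \<inter> x = u}" using h u'(3) unfolding slash_hyp_def by auto
  qed
  have "{h \<in> hyp v. v \<inter> x \<subseteq> h} \<subseteq> {h \<in> hyp v. u \<subseteq> h}" using u'(2) by auto
  then have "real (card {h \<in> slash_hyp v. h \<inter> x = u})
      = real (card {h \<in> hyp v. u \<subseteq> h}) - real (card {h \<in> hyp v. v \<inter> x \<subseteq> h})"
    unfolding eq by (simp add: card_Diff_subset card_mono of_nat_diff)
  also have "\<dots> = bracket (dim v - dim u) - bracket (dim v - dim (v \<inter> x))"
    using card_hyp_above[OF u'(1) v] card_hyp_above[OF subspace_Int_x[OF v] v] u'(2) by simp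
  also have "dim v - dim u = Suc (dim v - dim (v \<inter> x))"
    using u'(3) dim_Int_x_le(2)[of v] by simp
  finally show ?thesis by (simp add: bracket_Suc)
qed

lemma R1_lift: "R1 *v lift i j g = complex_of_real (real q ^ j) *s lift (Suc i) j (up x *v g)"
proof (rule vec_eq_iff[THEN iffD2], rule allI)
  fix v
  show "(R1 *v lift i j g) $ v = (complex_of_real (real q ^ j) *s lift (Suc i) j (up x *v g)) $ v"
  proof (cases "subspace v")
    case True
    have iff: "h \<in> P_part i j \<longleftrightarrow> v \<in> P_part (Suc i) j" "h \<inter> x \<in> hyp (v \<inter> x)" if "h \<in> slash_hyp v" for h
    proof -
      have h: "subspace h" "h \<subseteq> v" "dim v = Suc (dim h)" "dim (v \<inter> x) = Suc (dim (h \<inter> x))"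
        using that unfolding slash_hyp_def hyp_def by auto
      then show "h \<in> P_part i j \<longleftrightarrow> v \<in> P_part (Suc i) j" using True unfolding P_part_iff by auto
      show "h \<inter> x \<in> hyp (v \<inter> x)" using h subspace_Int_x unfolding hyp_def by auto
    qed
    have "(R1 *v lift i j g) $ v = (\<Sum>h\<in>slash_hyp v. if v \<in> P_part (Suc i) j then g $ (h \<inter> x) else 0)"
      using True iff by (auto simp: R1_nth lift_nth intro!: sum.cong)
    also have "\<dots> = (if v \<in> P_part (Suc i) j then \<Sum>h\<in>slash_hyp v. g $ (h \<inter> x) else 0)" by simp
    also have "(\<Sum>h\<in>slash_hyp v. g $ (h \<inter> x))
        = (\<Sum>u\<in>hyp (v \<inter> x). \<Sum>h\<in>{h \<in> slash_hyp v. h \<inter> x = u}. g $ (h \<inter> x))"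
      by (rule sum.group[symmetric]) (use iff(2) in auto)
    also have "\<dots> = (\<Sum>u\<in>hyp (v \<inter> x). complex_of_real (real q ^ (dim v - dim (v \<inter> x))) * g $ u)"
    proof (rule sum.cong[OF refl])
      fix u assume u: "u \<in> hyp (v \<inter> x)"
      have "(\<Sum>h\<in>{h \<in> slash_hyp v. h \<inter> x = u}. g $ (h \<inter> x))
          = complex_of_real (real (card {h \<in> slash_hyp v. h \<inter> x = u})) * g $ u" by simp
      then show "(\<Sum>h\<in>{h \<in> slash_hyp v. h \<inter> x = u}. g $ (h \<inter> x))
          = complex_of_real (real q ^ (dim v - dim (v \<inter> x))) * g $ u"
        unfolding card_slash_hyp_fibre[OF True u] .
    qed
    also have "\<dots> = complex_of_real (real q ^ (dim v - dim (v \<inter> x))) * (up x *v g) $ (v \<inter> x)"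
      using subspace_Int_x[OF True] by (simp add: up_nth sum_distrib_left)
    finally show ?thesis by (simp add: lift_nth P_part_iff)
  qed (simp add: R1_nth lift_nth P_part_iff)
qed

end

lemma is_module_gen_subalgebraI:
  assumes "vec.subspace W" "W \<subseteq> supported_vecs S"
    and "\<And>M w. M \<in> G \<Longrightarrow> w \<in> W \<Longrightarrow> M *v w \<in> W"
  shows "is_module S (gen_subalgebra S G) W"
proof -
  have "\<forall>w\<in>W. M *v w \<in> W" if "M \<in> gen_subalgebra S G" for M
    using that
  proof induction
    case (gen M)
    then show ?case using assms(3) by blast
  next
    case unit
    have "diag_on S (\<lambda>_. 1) *v w = w" if "w \<in> W" for w
      using that assms(2) unfolding supported_vecs_def by (auto simp: vec_eq_iff diag_on_nth)
    then show ?case by simp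
  next
    case (add M M')
    then show ?case
      using assms(1) by (simp add: matrix_vector_mult_add_rdistrib vec.subspace_add)
  next
    case (smult M c)
    have "(\<chi> i j. c * M $ i $ j) *v w = c *s (M *v w)" for w
      by (simp add: vec_eq_iff matrix_vector_mult_def sum_distrib_left mult.assoc)
    then show ?case using smult assms(1) by (simp add: vec.subspace_scale)
  next
    case (mult M M')
    then show ?case by (simp add: matrix_vector_mul_assoc[symmetric])
  qed
  then show ?thesis using assms(1,2) unfolding is_module_def by blast
qed

lemma is_module_gen: "is_module S (gen_subalgebra S G) W \<Longrightarrow> M \<in> G \<Longrightarrow> w \<in> W \<Longrightarrow> M *v w \<in> W"
  unfolding is_module_def using gen_subalgebra.gen by blast

lemma is_module_subspace: "is_module S B W \<Longrightarrow> vec.subspace W"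
  unfolding is_module_def by blast

lemma is_module_Int: "is_module S B W \<Longrightarrow> is_module S B W' \<Longrightarrow> is_module S B (W \<inter> W')"
  unfolding is_module_def by (auto simp: vec.subspace_inter)

lemma irreducible_subset:
  assumes "is_irreducible_module S B W" "is_module S B W'" "v \<in> W" "v \<in> W'" "v \<noteq> 0"
  shows "W \<subseteq> W'"
proof -
  have "is_module S B (W \<inter> W')"
    using assms(1,2) is_module_Int unfolding is_irreducible_module_def by blast
  then have "W \<inter> W' = {0} \<or> W \<inter> W' = W"
    using assms(1) unfolding is_irreducible_module_def by blast
  then show ?thesis using assms(3-5) by blast
qed

lemma span_closed_matrix:
  fixes M :: "complex ^ 'i::finite ^ 'i"
  assumes "vec.subspace W" "\<And>b. b \<in> B \<Longrightarrow> M *v b \<in> W" "f \<in> vec.span B"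
  shows "M *v f \<in> W"
  using assms(3)
proof (induction rule: vec.span_induct)
  case base
  then show ?case unfolding vec.subspace_def
    using assms(1) by (auto simp: matrix_vector_right_distrib matrix_vector_mult_smult
        vec.subspace_add vec.subspace_scale vec.subspace_0)
next
  case (step b)
  then show ?case using assms(2) by blast
qed

context grassmann
begin

lemma adjacent_dim_Int_x:
  assumes "adjacent y z"
  shows "dim (x \<inter> z) \<le> Suc (dim (x \<inter> y))"
proof -
  have y: "subspace y" "dim y = D" and z: "subspace z" "dim z = D" and yz: "dim (y \<inter> z) = D - 1"
    using assms unfolding adjacent_def vertices_def by auto
  have s: "subspace (y \<inter> z)" "subspace (x \<inter> z)" using y z subspace_x subspace_inter by auto
  have "dim ((y \<inter> z) \<oplus>s (x \<inter> z)) + dim ((y \<inter> z) \<inter> (x \<inter> z)) = D - 1 + dim (x \<inter> z)"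
    using dim_ssum[OF s] yz by simp
  moreover have "dim ((y \<inter> z) \<oplus>s (x \<inter> z)) \<le> D"
    unfolding z(2)[symmetric] by (intro dim_mono ssum_least z(1)) auto
  moreover have "dim ((y \<inter> z) \<inter> (x \<inter> z)) \<le> dim (x \<inter> y)" by (rule dim_mono) auto
  ultimately show ?thesis using D_ge_1 by linarith
qed

lemma adjacent_closer:
  assumes "y \<in> vertices" "dim (x \<inter> y) < D"
  shows "\<exists>z. adjacent z y \<and> dim (x \<inter> z) = Suc (dim (x \<inter> y))"
proof -
  have y: "subspace y" "dim y = D" using assms unfolding vertices_def by auto
  let ?u = "x \<inter> y"
  have u: "subspace ?u" using y subspace_x subspace_inter by blast
  obtain h where h: "subspace h" "?u \<subseteq> h" "h \<subseteq> y" "dim h = D - 1"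
  proof -
    have "?u \<subseteq> y" "dim ?u \<le> D - 1" "D - 1 \<le> dim y" using assms(2) y(2) by auto
    from exists_between[OF u y(1) this] show ?thesis using that by blast
  qed
  obtain v where v: "subspace v" "?u \<subseteq> v" "v \<subseteq> x" "dim v = Suc (dim ?u)"
  proof -
    have "?u \<subseteq> x" "dim ?u \<le> Suc (dim ?u)" "Suc (dim ?u) \<le> dim x" using assms(2) dim_x by auto
    from exists_between[OF u subspace_x this] show ?thesis using that by blast
  qed
  have hv: "h \<inter> v = ?u" using h v by auto
  have sz: "subspace (h \<oplus>s v)" using h v subspace_ssum by blast
  have "dim (h \<oplus>s v) = D" using dim_ssum[OF h(1) v(1)] hv h(4) v(4) D_ge_1 by simp
  then have z: "h \<oplus>s v \<in> vertices" using sz unfolding vertices_def by simp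
  have up: "h \<subseteq> h \<oplus>s v" "v \<subseteq> h \<oplus>s v" using h v ssum_upper1 ssum_upper2 by auto
  have "dim ((h \<oplus>s v) \<inter> y) = D - 1"
  proof -
    have "(h \<oplus>s v) \<inter> y = h \<oplus>s (v \<inter> y)" by (rule modular_law[OF y(1) h(3)])
    also have "v \<inter> y = ?u" using v by auto
    also have "h \<oplus>s ?u = h" using ssum_absorb[OF u h(1,2)] ssum_commute by simp
    finally show ?thesis using h by simp
  qed
  then have adj: "adjacent (h \<oplus>s v) y" using z assms(1) unfolding adjacent_def by simp
  have "dim v \<le> dim (x \<inter> (h \<oplus>s v))" using v up by (intro dim_mono) auto
  moreover have "adjacent y (h \<oplus>s v)" using adj unfolding adjacent_def by (simp add: Int_commute)
  then have "dim (x \<inter> (h \<oplus>s v)) \<le> Suc (dim ?u)" by (rule adjacent_dim_Int_x)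
  ultimately show ?thesis using adj v(4) by (intro exI[of _ "h \<oplus>s v"]) simp
qed

lemma path_dist_eq:
  assumes "y \<in> vertices"
  shows "path_dist x y = D - dim (y \<inter> x)"
proof -
  have ex: "(x, y) \<in> {(u, v). adjacent u v} ^^ n" if "y \<in> vertices" "dim (x \<inter> y) + n = D" for y n
    using that
  proof (induction n arbitrary: y)
    case 0
    then have y: "subspace y" "dim y = D" unfolding vertices_def by auto
    have "subspace (x \<inter> y)" using y subspace_x subspace_inter by blast
    then have "x \<inter> y = x" "x \<inter> y = y"
      using dim_eqD[of "x \<inter> y" x] dim_eqD[of "x \<inter> y" y] y subspace_x dim_x 0 by auto
    then show ?case by simp
  next
    case (Suc n)
    then obtain z where z: "adjacent z y" "dim (x \<inter> z) = Suc (dim (x \<inter> y))"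
      using adjacent_closer[of y] by auto
    then have "(x, z) \<in> {(u, v). adjacent u v} ^^ n"
      using Suc unfolding adjacent_def by auto
    then show ?case using z(1) by (intro relpow_Suc_I[of x z]) auto
  qed
  have le: "D \<le> dim (x \<inter> y) + n" if "(x, y) \<in> {(u, v). adjacent u v} ^^ n" for y n
    using that
  proof (induction n arbitrary: y)
    case 0
    then show ?case using dim_x by simp
  next
    case (Suc n)
    then obtain z where "(x, z) \<in> {(u, v). adjacent u v} ^^ n" "adjacent z y" by auto
    moreover from this have "adjacent y z" unfolding adjacent_def by (auto simp: Int_commute)
    ultimately have "D \<le> dim (x \<inter> z) + n" "dim (x \<inter> z) \<le> Suc (dim (x \<inter> y))"
      using Suc.IH adjacent_dim_Int_x by auto
    then show ?case by simp
  qed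
  have "dim (x \<inter> y) \<le> D" using dim_mono[of "x \<inter> y" x] dim_x by simp
  then have "(x, y) \<in> {(u, v). adjacent u v} ^^ (D - dim (x \<inter> y))" using ex[OF assms] by simp
  then have "(LEAST n. (x, y) \<in> {(u, v). adjacent u v} ^^ n) = D - dim (x \<inter> y)"
    by (rule Least_equality) (use le in force)
  then show ?thesis unfolding path_dist_def by (simp add: Int_commute)
qed

lemma E_star_eq:
  assumes "i \<le> D"
  shows "E_star i = EP_star (D - i) i"
proof -
  have "y \<in> vertices \<and> path_dist x y = i \<longleftrightarrow> y \<in> P_part (D - i) i" for y
  proof
    assume y: "y \<in> vertices \<and> path_dist x y = i"
    then have "D - dim (y \<inter> x) = i" using path_dist_eq by auto
    moreover have "dim (y \<inter> x) \<le> D" by (rule dim_Int_x_le)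
    ultimately show "y \<in> P_part (D - i) i"
      using y unfolding P_part_iff vertices_def by auto
  next
    assume "y \<in> P_part (D - i) i"
    then have "y \<in> vertices" "dim (y \<inter> x) = D - i"
      using assms unfolding P_part_iff vertices_def by auto
    then show "y \<in> vertices \<and> path_dist x y = i" using path_dist_eq assms by simp
  qed
  then show ?thesis unfolding E_star_def EP_star_def diag_on_def by (auto simp: vec_eq_iff)
qed

lemma EP_star_nth: "(EP_star i j *v f) $ w = (if w \<in> P_part i j then f $ w else 0)"
  unfolding EP_star_def by (simp add: diag_on_nth)

lemma EP_star_lift: "EP_star i j *v lift i' j' g = (if i = i' \<and> j = j' then lift i j g else 0)"
  by (auto simp: vec_eq_iff EP_star_nth lift_nth P_part_iff)

lemma sum_EP_star:
  assumes "f \<in> supported_vecs P"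
  shows "f = (\<Sum>(i, j)\<in>{..D} \<times> {..N - D}. EP_star i j *v f)"
proof (rule vec_eq_iff[THEN iffD2], rule allI)
  fix w
  have "(\<Sum>(i, j)\<in>{..D} \<times> {..N - D}. EP_star i j *v f) $ w
      = (\<Sum>p\<in>{..D} \<times> {..N - D}. if w \<in> P_part (fst p) (snd p) then f $ w else 0)"
    by (simp add: EP_star_nth case_prod_beta)
  also have "\<dots> = f $ w"
  proof (cases "subspace w")
    case True
    let ?p = "(dim (w \<inter> x), dim w - dim (w \<inter> x))"
    have "w \<in> P_part (fst p) (snd p) \<longleftrightarrow> p = ?p" for p
      using True dim_Int_x_le(2)[of w] by (cases p) (auto simp: P_part_iff)
    moreover have "?p \<in> {..D} \<times> {..N - D}"
      using P_partD[of w "fst ?p" "snd ?p"] True dim_Int_x_le(2)[of w] by (simp add: P_part_iff)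
    ultimately show ?thesis by simp
  next
    case False
    then have "f $ w = 0" using assms unfolding supported_vecs_def P_def by blast
    then show ?thesis by (intro trans[OF sum.neutral]) auto
  qed
  finally show "f $ w = (\<Sum>(i, j)\<in>{..D} \<times> {..N - D}. EP_star i j *v f) $ w" by simp
qed

lemma sum_EP_star_vertices:
  assumes "f \<in> supported_vecs vertices"
  shows "f = (\<Sum>i\<le>D. EP_star (D - i) i *v f)"
proof (rule vec_eq_iff[THEN iffD2], rule allI)
  fix w
  have "(\<Sum>i\<le>D. EP_star (D - i) i *v f) $ w = (\<Sum>i\<le>D. if w \<in> P_part (D - i) i then f $ w else 0)"
    by (simp add: EP_star_nth)
  also have "\<dots> = f $ w"
  proof (cases "w \<in> vertices")
    case True
    then have "w \<in> P_part (D - i) i \<longleftrightarrow> i = D - dim (w \<inter> x)" if "i \<in> {..D}" for i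
      using that dim_Int_x_le(1)[of w] unfolding P_part_iff vertices_def by auto
    then have "(\<Sum>i\<le>D. if w \<in> P_part (D - i) i then f $ w else 0)
        = (\<Sum>i\<le>D. if i = D - dim (w \<inter> x) then f $ w else 0)"
      by (intro sum.cong) auto
    then show ?thesis by simp
  next
    case False
    then have "f $ w = 0" using assms unfolding supported_vecs_def by blast
    then show ?thesis by (intro trans[OF sum.neutral]) auto
  qed
  finally show "f $ w = (\<Sum>i\<le>D. EP_star (D - i) i *v f) $ w" by simp
qed

definition trace_functions :: "(complex ^ 'v set) set" where
  "trace_functions = vec.span {lift i j g | i j g. True}"

lemma subspace_trace_functions: "vec.subspace trace_functions"
  unfolding trace_functions_def by (rule vec.subspace_span)

lemma lift_trace_functions: "lift i j g \<in> trace_functions"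
  unfolding trace_functions_def by (intro vec.span_base) blast

lemma R1_trace_functions: "f \<in> trace_functions \<Longrightarrow> R1 *v f \<in> trace_functions" and R2_trace_functions: "f \<in> trace_functions \<Longrightarrow> R2 *v f \<in> trace_functions"
  and L1_trace_functions: "f \<in> trace_functions \<Longrightarrow> L1 *v f \<in> trace_functions" and L2_trace_functions: "f \<in> trace_functions \<Longrightarrow> L2 *v f \<in> trace_functions"
proof -
  note s = vec.subspace_scale[OF subspace_trace_functions lift_trace_functions]
  have L1: "L1 *v lift i j g \<in> trace_functions" for i j g
    by (cases i) (auto simp: L1_lift_0 L1_lift lift_trace_functions vec.subspace_0[OF subspace_trace_functions])
  have L2: "L2 *v lift i j g \<in> trace_functions" for i j g
    by (cases j) (simp_all only: L2_lift_0 L2_lift s vec.subspace_0[OF subspace_trace_functions])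
  have R1: "R1 *v lift i j g \<in> trace_functions" for i j g by (simp only: R1_lift s)
  have R2: "R2 *v lift i j g \<in> trace_functions" for i j g by (simp only: R2_lift s)
  have step: "M *v f \<in> trace_functions" if "f \<in> trace_functions" "\<And>i j g. M *v lift i j g \<in> trace_functions" for M f
    using span_closed_matrix[OF subspace_trace_functions _ that(1)[unfolded trace_functions_def]] that(2) by auto
  assume f: "f \<in> trace_functions"
  show "R1 *v f \<in> trace_functions" "R2 *v f \<in> trace_functions" "L1 *v f \<in> trace_functions" "L2 *v f \<in> trace_functions"
    using step[OF f R1] step[OF f R2] step[OF f L1] step[OF f L2] .
qed

lemma EP_star_trace_functions:
  assumes "f \<in> trace_functions"
  shows "\<exists>g\<in>level_vecs x i. EP_star i j *v f = lift i j g"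
proof -
  have "\<exists>g. EP_star i j *v f = lift i j g"
    using assms unfolding trace_functions_def
  proof (induction rule: vec.span_induct)
    case base
    show ?case unfolding vec.subspace_def
    proof (intro conjI ballI allI)
      show "0 \<in> {f. \<exists>g. EP_star i j *v f = lift i j g}" by (auto intro: exI[of _ 0])
    next
      fix f f' assume "f \<in> {f. \<exists>g. EP_star i j *v f = lift i j g}" "f' \<in> {f. \<exists>g. EP_star i j *v f = lift i j g}"
      then obtain g g' where "EP_star i j *v f = lift i j g" "EP_star i j *v f' = lift i j g'" by blast
      then have "EP_star i j *v (f + f') = lift i j (g + g')"
        by (simp add: matrix_vector_right_distrib lift_add)
      then show "f + f' \<in> {f. \<exists>g. EP_star i j *v f = lift i j g}" by blast
    next
      fix c f assume "f \<in> {f. \<exists>g. EP_star i j *v f = lift i j g}"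
      then obtain g where "EP_star i j *v f = lift i j g" by blast
      then have "EP_star i j *v (c *s f) = lift i j (c *s g)"
        by (simp add: matrix_vector_mult_smult lift_smult)
      then show "c *s f \<in> {f. \<exists>g. EP_star i j *v f = lift i j g}" by blast
    qed
  next
    case (step f)
    then obtain i' j' g where f: "f = lift i' j' g" by blast
    then show ?case
      by (cases "i = i' \<and> j = j'") (auto simp: EP_star_lift intro: exI[of _ 0])
  qed
  then show ?thesis using lift_restrict by metis
qed

lemma adjacency_eq_RL:
  assumes "f \<in> supported_vecs vertices"
  shows "adjacency_matrix *v f = R1 *v (L1 *v f) + R1 *v (L2 *v f) + R2 *v (L1 *v f) + R2 *v (L2 *v f)
    - complex_of_real (bracket D) *s f"
  using adjacency_eq_up_down[of f] assms unfolding supported_vecs_vertices down_UNIV up_UNIV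
  by (simp add: matrix_vector_right_distrib)

lemma adjacency_supported: "adjacency_matrix *v f \<in> supported_vecs vertices"
  unfolding supported_vecs_def adjacency_matrix_def matrix_vector_mult_def adjacent_def by simp

lemma T_module_Int_vertices:
  assumes W: "vec.subspace W"
    and "\<And>f. f \<in> W \<Longrightarrow> R1 *v f \<in> W" "\<And>f. f \<in> W \<Longrightarrow> R2 *v f \<in> W"
    and "\<And>f. f \<in> W \<Longrightarrow> L1 *v f \<in> W" "\<And>f. f \<in> W \<Longrightarrow> L2 *v f \<in> W"
    and "\<And>i j f. f \<in> W \<Longrightarrow> EP_star i j *v f \<in> W"
  shows "is_module vertices T_algebra (W \<inter> supported_vecs vertices)"
  unfolding T_algebra_def
proof (rule is_module_gen_subalgebraI)
  show "vec.subspace (W \<inter> supported_vecs vertices)"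
    using W subspace_supported_vecs by (rule vec.subspace_inter)
  fix M f assume M: "M \<in> {adjacency_matrix} \<union> E_star ` {0..D}" and f: "f \<in> W \<inter> supported_vecs vertices"
  then have f1: "f \<in> W" and f2: "f \<in> supported_vecs vertices" by auto
  show "M *v f \<in> W \<inter> supported_vecs vertices"
  proof (cases "M = adjacency_matrix")
    case True
    have "adjacency_matrix *v f \<in> W"
      unfolding adjacency_eq_RL[OF f2]
      by (intro vec.subspace_diff[OF W] vec.subspace_add[OF W] vec.subspace_scale[OF W] assms(2-5) f1)
    then show ?thesis using True adjacency_supported by blast
  next
    case False
    then obtain i where i: "i \<le> D" "M = E_star i" using M by auto
    have "E_star i *v f \<in> W" unfolding E_star_eq[OF i(1)] using f1 by (rule assms(6))
    moreover have "E_star i *v f \<in> supported_vecs vertices"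
      unfolding E_star_def supported_vecs_def by (simp add: diag_on_nth)
    ultimately show ?thesis using i(2) by blast
  qed
qed auto

lemma T_module_trace_functions: "is_module vertices T_algebra (trace_functions \<inter> supported_vecs vertices)"
proof (rule T_module_Int_vertices[OF subspace_trace_functions R1_trace_functions R2_trace_functions L1_trace_functions L2_trace_functions])
  show "EP_star i j *v f \<in> trace_functions" if "f \<in> trace_functions" for i j f
    using EP_star_trace_functions[OF that, of i j] lift_trace_functions by auto
qed auto

end

section \<open>The nucleus\<close>

context grassmann
begin

lemma T_module_adjacency: "is_module vertices T_algebra W \<Longrightarrow> w \<in> W \<Longrightarrow> adjacency_matrix *v w \<in> W"
  unfolding T_algebra_def by (rule is_module_gen) auto

lemma T_module_E_star: "is_module vertices T_algebra W \<Longrightarrow> i \<le> D \<Longrightarrow> w \<in> W \<Longrightarrow> E_star i *v w \<in> W"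
  unfolding T_algebra_def by (rule is_module_gen) auto

lemma T_module_supported: "is_module vertices T_algebra W \<Longrightarrow> W \<subseteq> supported_vecs vertices"
  unfolding is_module_def by blast

lemma upn_restrict:
  "upn T m (\<chi> u. if u \<subseteq> T then c $ u else 0) $ y = (if y \<subseteq> T then upn UNIV m c $ y else 0)"
proof (induction m arbitrary: y)
  case (Suc m)
  have "h \<subseteq> T" if "y \<subseteq> T" "h \<in> hyp y" for h using that unfolding hyp_def by blast
  then show ?case by (simp add: up_nth Suc.IH)
qed simp

text \<open>A \<open>t\<close>-space \<open>w\<close> not contained in \<open>x\<close> lies in a subspace \<open>H\<close> with \<open>dim (H \<inter> x) < t\<close> and
  \<open>dim H \<ge> D + t\<close>. All \<open>D\<close>-subspaces of \<open>H\<close> are covered by the vanishing hypothesis, so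
  \<open>c\<close> vanishes on \<open>H\<close> by the injectivity of the iterated raising map on \<open>H\<close>.\<close>

lemma support_in_x:
  assumes c: "c \<in> level_vecs UNIV t" and "t \<le> D"
    and van: "\<And>y. y \<in> vertices \<Longrightarrow> dim (y \<inter> x) < t \<Longrightarrow> upn UNIV (D - t) c $ y = 0"
  shows "c \<in> level_vecs x t"
  unfolding level_vecs_def
proof clarify
  fix w assume cw: "c $ w \<noteq> 0"
  then have w: "subspace w" "dim w = t" using level_vecsD[OF c] by auto
  have "w \<subseteq> x"
  proof (rule ccontr)
    assume "\<not> w \<subseteq> x"
    then have "dim (w \<inter> x) < t" using dim_less[OF subspace_Int_x[OF w(1)] w(1)] w(2) by blast
    then have t: "dim (w \<inter> x) \<le> t - 1" "t - 1 \<le> dim x" "0 < t" using assms(2) dim_x by auto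
    obtain x' where x': "subspace x'" "w \<inter> x \<subseteq> x'" "x' \<subseteq> x" "dim x' = t - 1"
      using exists_between[OF subspace_Int_x[OF w(1)] subspace_x _ t(1,2)] by blast
    let ?A = "x' \<oplus>s w"
    have A: "subspace ?A" "w \<subseteq> ?A" using subspace_ssum[OF x'(1) w(1)] ssum_upper2[OF x'(1)] by auto
    have "?A \<inter> x = x' \<oplus>s (w \<inter> x)" by (rule modular_law[OF subspace_x x'(3)])
    also have "\<dots> = x'"
      using ssum_absorb[OF subspace_Int_x[OF w(1)] x'(1,2)] ssum_commute by simp
    finally have Ax: "?A \<inter> x = x'" .
    have "dim (?A \<oplus>s x) + (N - dim (?A \<oplus>s x)) \<le> dim UNIV" using dim_le_N by simp
    from exists_extension[OF A(1) subspace_x subspace_UNIV _ _ this]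
    obtain H where H: "subspace H" "?A \<subseteq> H" "H \<inter> x = x'" "dim H = dim ?A + (N - dim (?A \<oplus>s x))"
      using Ax by auto
    have "D + t \<le> dim H"
      using dim_ssum[OF A(1) subspace_x] H(4) dim_le_N[of "?A \<oplus>s x"] x'(4) t(3) dim_x N_gt
      unfolding Ax by linarith
    define cH where "cH = (\<chi> u. if u \<subseteq> H then c $ u else 0)"
    have "cH \<in> level_vecs H t" using level_vecsD[OF c] unfolding level_vecs_def cH_def by auto
    moreover have "upn H (D - t) cH = 0"
    proof (rule vec_eq_iff[THEN iffD2], rule allI, rule ccontr)
      fix y assume "upn H (D - t) cH $ y \<noteq> 0 $ y"
      then have y: "y \<subseteq> H" "upn UNIV (D - t) c $ y \<noteq> 0"
        unfolding cH_def upn_restrict by (auto split: if_splits)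
      then have "y \<in> vertices"
        using level_vecsD[OF upn_level_vecs[OF c]] assms(2) unfolding vertices_def by fastforce
      moreover have "dim (y \<inter> x) \<le> dim x'"
        using y(1) H(3) by (intro dim_mono) auto
      then have "dim (y \<inter> x) < t" using x'(4) t(3) by simp
      ultimately show False using van y(2) by blast
    qed
    moreover have "2 * t + (D - t) \<le> dim H" using \<open>D + t \<le> dim H\<close> assms(2) by simp
    ultimately have "cH = 0" using upn_inj[OF H(1)] by blast
    moreover have "w \<subseteq> H" using A H by blast
    then have "cH $ w = c $ w" unfolding cH_def by simp
    ultimately show False using cw by simp
  qed
  then show "subspace w \<and> w \<subseteq> x \<and> dim w = t" using w by blast
qed

lemma level_vecs_x_eq_lift:
  assumes "c \<in> level_vecs x t"
  shows "c = lift t 0 c"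
proof (rule vec_eq_iff[THEN iffD2], rule allI)
  fix w
  show "c $ w = lift t 0 c $ w"
  proof (cases "w \<in> P_part t 0")
    case True
    then have "subspace w" "dim w \<le> dim (w \<inter> x)" unfolding P_part_iff by auto
    then have "w \<inter> x = w" using dim_eqD[OF subspace_Int_x, of w w] by auto
    then show ?thesis using True by (simp add: lift_nth)
  next
    case False
    have "c $ w = 0"
    proof (rule ccontr)
      assume "c $ w \<noteq> 0"
      then have w: "subspace w" "w \<subseteq> x" "dim w = t" using level_vecsD[OF assms] by auto
      then have "w \<inter> x = w" by blast
      then show False using False w unfolding P_part_iff by simp
    qed
    then show ?thesis using False by (simp add: lift_nth)
  qed
qed

lemma upn_trace_functions: "c \<in> trace_functions \<Longrightarrow> upn UNIV m c \<in> trace_functions"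
  by (induction m) (auto simp: up_UNIV intro!: vec.subspace_add[OF subspace_trace_functions] R1_trace_functions R2_trace_functions)

lemma E_star_nth:
  assumes "y \<in> vertices"
  shows "(E_star i *v f) $ y = (if D - dim (y \<inter> x) = i then f $ y else 0)"
  unfolding E_star_def using assms path_dist_eq by (simp add: diag_on_nth)

lemma image_ne_0_iff: "vec.subspace W \<Longrightarrow> (*v) M ` W \<noteq> {0} \<longleftrightarrow> (\<exists>w\<in>W. M *v w \<noteq> 0)"
  for M :: "complex ^ 'v set ^ 'v set"
  using vec.subspace_0[of W] by (auto intro!: image_eqI[of 0 _ 0])

lemma E_star_ne_0:
  assumes "f \<in> supported_vecs vertices" "f \<noteq> 0"
  shows "\<exists>i\<le>D. E_star i *v f \<noteq> 0"
proof -
  obtain y where "f $ y \<noteq> 0" using assms(2) by (auto simp: vec_eq_iff)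
  moreover from this have "y \<in> vertices" using assms(1) unfolding supported_vecs_def by blast
  ultimately have "(E_star (D - dim (y \<inter> x)) *v f) $ y \<noteq> 0" by (simp add: E_star_nth)
  then show ?thesis by (intro exI[of _ "D - dim (y \<inter> x)"]) auto
qed

text \<open>The part of an irreducible module supported at distance less than \<open>s\<close> from \<open>x\<close> is a
  submodule as soon as nothing lives at distance \<open>s\<close>.\<close>

lemma endpoint_support_interval:
  assumes irr: "is_irreducible_module vertices T_algebra W"
    and v: "v \<in> W" "E_star r *v v \<noteq> 0" and s: "r < s" "s \<le> D" "\<And>w. w \<in> W \<Longrightarrow> E_star s *v w = 0"
    and w: "w \<in> W" and i: "s \<le> i" "i \<le> D"
  shows "E_star i *v w = 0"
proof -
  have mod: "is_module vertices T_algebra W" using irr unfolding is_irreducible_module_def by blast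
  define Z where "Z = {f. \<forall>y\<in>vertices. s \<le> D - dim (y \<inter> x) \<longrightarrow> f $ y = 0} \<inter> W"
  have Z: "is_module vertices T_algebra Z"
    unfolding T_algebra_def
  proof (rule is_module_gen_subalgebraI)
    have "vec.subspace {f :: complex ^ 'v set. \<forall>y\<in>vertices. s \<le> D - dim (y \<inter> x) \<longrightarrow> f $ y = 0}"
      unfolding vec.subspace_def by simp
    then show "vec.subspace Z"
      unfolding Z_def using is_module_subspace[OF mod] by (rule vec.subspace_inter)
    show "Z \<subseteq> supported_vecs vertices" unfolding Z_def using T_module_supported[OF mod] by blast
    fix M f assume M: "M \<in> {adjacency_matrix} \<union> E_star ` {0..D}" and f: "f \<in> Z"
    then have fW: "f \<in> W" and f0: "\<And>y. y \<in> vertices \<Longrightarrow> s \<le> D - dim (y \<inter> x) \<Longrightarrow> f $ y = 0"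
      unfolding Z_def by auto
    show "M *v f \<in> Z"
    proof (cases "M = adjacency_matrix")
      case True
      have "(adjacency_matrix *v f) $ y = 0" if y: "y \<in> vertices" "s \<le> D - dim (y \<inter> x)" for y
      proof (cases "D - dim (y \<inter> x) = s")
        case True
        have "E_star s *v (adjacency_matrix *v f) = 0"
          by (rule s(3)) (rule T_module_adjacency[OF mod fW])
        then have "(E_star s *v (adjacency_matrix *v f)) $ y = 0" by simp
        then show ?thesis using True E_star_nth[OF y(1)] by simp
      next
        case False
        have "(if adjacent y z then 1 else 0) * f $ z = 0" for z
        proof (cases "adjacent y z")
          case True
          then have "dim (x \<inter> z) \<le> Suc (dim (x \<inter> y))" "z \<in> vertices"
            using adjacent_dim_Int_x unfolding adjacent_def by auto
          then have "f $ z = 0" using f0[of z] y(2) False by (simp add: Int_commute)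
          then show ?thesis by simp
        qed simp
        then show ?thesis
          unfolding adjacency_matrix_def matrix_vector_mult_def vec_lambda_beta
          by (intro sum.neutral ballI)
      qed
      then show ?thesis using True T_module_adjacency[OF mod fW] unfolding Z_def by simp
    next
      case False
      then obtain k where k: "M = E_star k" "k \<le> D" using M by auto
      then show ?thesis
        using T_module_E_star[OF mod k(2) fW] f0 unfolding Z_def by (simp add: E_star_nth)
    qed
  qed
  have "E_star r *v v \<in> Z"
    unfolding Z_def using T_module_E_star[OF mod _ v(1)] s(1,2) by (auto simp: E_star_nth)
  moreover have "E_star r *v v \<in> W" using T_module_E_star[OF mod _ v(1)] s(1,2) by simp
  ultimately have "W \<subseteq> Z" using irreducible_subset[OF irr Z] v(2) by blast
  then have "w \<in> Z" using w by blast
  then have "(E_star i *v w) $ y = 0" for y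
    using i unfolding Z_def
    by (cases "y \<in> vertices") (auto simp: E_star_nth, simp add: E_star_def diag_on_nth)
  then show ?thesis by (simp add: vec_eq_iff)
qed

lemma displacement_0_subset_trace_functions:
  assumes irr: "irreducible_T_module W" and disp: "displacement W = 0"
  shows "W \<subseteq> trace_functions"
proof -
  have irr': "is_irreducible_module vertices T_algebra W"
    using irr unfolding irreducible_T_module_def .
  then have mod: "is_module vertices T_algebra W" and ne: "W \<noteq> {0}"
    unfolding is_irreducible_module_def by auto
  have W: "vec.subspace W" "W \<subseteq> supported_vecs vertices"
    using mod unfolding is_module_def by auto
  have comp: "\<exists>f. (\<forall>i\<le>D. f i \<in> level_vecs UNIV i \<and> upn UNIV (D - i) (f i) \<in> W
      \<and> E i *v w = upn UNIV (D - i) (f i)) \<and> w = (\<Sum>i\<le>D. upn UNIV (D - i) (f i))"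
    if w: "w \<in> W" for w
  proof -
    have "w \<in> level_vecs UNIV D" using w W(2) supported_vecs_vertices by blast
    from eigspace_decomposition[OF this]
    obtain f where f: "\<forall>i\<le>D. f i \<in> level_vecs UNIV i \<and> upn UNIV (D - i) (f i) \<in> eigspace i"
      and weq: "w = (\<Sum>i\<le>D. upn UNIV (D - i) (f i))" by auto
    have "E i *v w = upn UNIV (D - i) (f i)" if "i \<le> D" for i
      unfolding weq by (rule E_sum_eigspace) (use f that in auto)
    moreover have "upn UNIV (D - i) (f i) \<in> W" if "i \<le> D" for i
    proof (rule eigen_components_in_invariant_subspace[OF W(1) T_module_adjacency[OF mod] _ eigval_inj])
      show "adjacency_matrix *v upn UNIV (D - j) (f j) = complex_of_real (eigval j) *s upn UNIV (D - j) (f j)"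
        if "j \<in> {..D}" for j using f that unfolding eigspace_def by blast
      show "(\<Sum>i\<le>D. upn UNIV (D - i) (f i)) \<in> W" using w weq by simp
    qed (use that in auto)
    ultimately show ?thesis using f weq by (intro exI[of _ f]) simp
  qed
  obtain w where w: "w \<in> W" "w \<noteq> 0" using ne vec.subspace_0[OF W(1)] by blast
  have "\<exists>i\<le>D. (*v) (E i) ` W \<noteq> {0}"
  proof (rule ccontr)
    assume "\<not> ?thesis"
    then have "\<forall>i\<le>D. E i *v w = 0" using w(1) image_ne_0_iff[OF W(1)] by blast
    moreover obtain f where "\<forall>i\<le>D. E i *v w = upn UNIV (D - i) (f i)"
      and weq: "w = (\<Sum>i\<le>D. upn UNIV (D - i) (f i))" using comp[OF w(1)] by auto
    ultimately have "w = 0" by simp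
    then show False using w(2) by simp
  qed
  then have "dual_endpoint W \<le> D \<and> (*v) (E (dual_endpoint W)) ` W \<noteq> {0}"
    unfolding dual_endpoint_def by (rule LeastI_ex)
  then obtain t where t: "t = dual_endpoint W" "t \<le> D" "(*v) (E t) ` W \<noteq> {0}" by blast
  then obtain w' where w': "w' \<in> W" "E t *v w' \<noteq> 0" using image_ne_0_iff[OF W(1)] by blast
  obtain c where c: "c \<in> level_vecs UNIV t" "upn UNIV (D - t) c \<in> W" "upn UNIV (D - t) c \<noteq> 0"
    using comp[OF w'(1)] w'(2) t(2) by auto
  define I where "I = {i. i \<le> D \<and> (*v) (E_star i) ` W \<noteq> {0}}"
  have "\<exists>i. i \<le> D \<and> (*v) (E_star i) ` W \<noteq> {0}"
    using E_star_ne_0[of w] w W image_ne_0_iff[OF W(1)] by blast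
  then have r: "endpoint W \<in> I" unfolding endpoint_def I_def mem_Collect_eq by (rule LeastI_ex)
  have r_le: "endpoint W \<le> i" if "i \<in> I" for i
    using that unfolding endpoint_def I_def mem_Collect_eq by (rule Least_le)
  have fin: "finite I" unfolding I_def by simp
  have "I = {endpoint W..Max I}"
  proof
    show "I \<subseteq> {endpoint W..Max I}" using r_le Max_ge[OF fin] by auto
    have "s \<in> I" if s: "endpoint W \<le> s" "s \<le> Max I" for s
    proof (rule ccontr)
      assume sI: "s \<notin> I"
      have m: "Max I \<in> I" using Max_in fin r by blast
      then have sD: "s \<le> D" using s(2) unfolding I_def by simp
      obtain v where v: "v \<in> W" "E_star (endpoint W) *v v \<noteq> 0"
        using r image_ne_0_iff[OF W(1)] unfolding I_def by blast
      have "endpoint W < s" using s(1) sI r by (cases "s = endpoint W") auto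
      moreover have "E_star s *v u = 0" if "u \<in> W" for u
        using sI sD that image_ne_0_iff[OF W(1)] unfolding I_def by blast
      ultimately have "E_star (Max I) *v u = 0" if "u \<in> W" for u
        using endpoint_support_interval[OF irr' v _ sD _ that s(2)] m unfolding I_def by blast
      then show False using m image_ne_0_iff[OF W(1)] unfolding I_def by blast
    qed
    then show "{endpoint W..Max I} \<subseteq> I" by auto
  qed
  moreover have "endpoint W \<le> Max I" using r Max_ge[OF fin] by blast
  ultimately have "int (card I) = int (Max I) - int (endpoint W) + 1"
    by (metis card_atLeastAtMost Suc_diff_le of_nat_Suc of_nat_diff add.commute)
  then have Max: "int (Max I) = int D - int t"
    using disp t(1) unfolding displacement_def module_diameter_def I_def by linarith
  have "upn UNIV (D - t) c $ y = 0" if y: "y \<in> vertices" "dim (y \<inter> x) < t" for y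
  proof -
    have "D - dim (y \<inter> x) \<notin> I"
      using Max_ge[OF fin, of "D - dim (y \<inter> x)"] Max y(2) t(2) by linarith
    then have "E_star (D - dim (y \<inter> x)) *v upn UNIV (D - t) c = 0"
      using c(2) image_ne_0_iff[OF W(1)] unfolding I_def by auto
    then have "(E_star (D - dim (y \<inter> x)) *v upn UNIV (D - t) c) $ y = 0" by simp
    then show ?thesis using E_star_nth[OF y(1)] by simp
  qed
  then have "c \<in> level_vecs x t" by (rule support_in_x[OF c(1) t(2)])
  then have "c \<in> trace_functions" using level_vecs_x_eq_lift lift_trace_functions by metis
  then have "upn UNIV (D - t) c \<in> trace_functions \<inter> supported_vecs vertices"
    using upn_trace_functions c(2) W(2) by blast
  then show ?thesis using irreducible_subset[OF irr' T_module_trace_functions c(2) _ c(3)] by blast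
qed

lemma nucleus_subset_trace_functions: "nucleus \<subseteq> trace_functions"
  unfolding nucleus_def using displacement_0_subset_trace_functions subspace_trace_functions
  by (intro vec.span_minimal) auto

end

section \<open>The modules generated by a lowest weight vector\<close>

context grassmann
begin

lemma H_module_gen:
  assumes "H_module U" "f \<in> U"
  shows "L1 *v f \<in> U" "L2 *v f \<in> U" "R1 *v f \<in> U" "R2 *v f \<in> U" "K1 *v f \<in> U" "K2 *v f \<in> U"
  using assms unfolding H_module_def H_algebra_def by (auto intro: is_module_gen)

lemma K1_EP_star:
  "K1 *v (EP_star i j *v f) = complex_of_real (real q powr (real D / 2 - real i)) *s (EP_star i j *v f)"
  unfolding K1_def by (auto simp: vec_eq_iff diag_on_nth EP_star_nth K1_entry_def P_part_iff P_def)

lemma K2_EP_star: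
  "K2 *v (EP_star i j *v f)
    = complex_of_real (real q powr (real (N - D) / 2 - real j)) *s (EP_star i j *v f)"
  unfolding K2_def by (auto simp: vec_eq_iff diag_on_nth EP_star_nth K2_entry_def P_part_iff P_def)

lemma inj_q_powr: "inj_on (\<lambda>i. complex_of_real (real q powr (a - real i))) A"
  using q_ge_2 by (auto simp: inj_on_def powr_inj)

lemma H_module_EP_star:
  assumes U: "H_module U" and f: "f \<in> U"
  shows "EP_star i j *v f \<in> U"
proof (cases "i \<le> D \<and> j \<le> N - D")
  case True
  have s: "vec.subspace U" "f \<in> supported_vecs P"
    using U f unfolding H_module_def is_module_def by auto
  have sum: "f = (\<Sum>i\<le>D. \<Sum>j\<le>N - D. EP_star i j *v f)"
    using sum_EP_star[OF s(2)] by (simp add: sum.cartesian_product)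
  have row: "(\<Sum>j\<le>N - D. EP_star i j *v f) \<in> U"
  proof (rule eigen_components_in_invariant_subspace[where M = K1 and I = "{..D}"
        and p = "\<lambda>i. \<Sum>j\<le>N - D. EP_star i j *v f"
        and \<theta> = "\<lambda>i. complex_of_real (real q powr (real D / 2 - real i))",
        OF s(1) H_module_gen(5)[OF U] _ inj_q_powr])
    show "K1 *v (\<Sum>j\<le>N - D. EP_star i j *v f)
      = complex_of_real (real q powr (real D / 2 - real i)) *s (\<Sum>j\<le>N - D. EP_star i j *v f)" for i
      by (simp only: matrix_vector_mult_sum K1_EP_star vec.scale_sum_right)
    show "(\<Sum>i\<le>D. \<Sum>j\<le>N - D. EP_star i j *v f) \<in> U" using sum f by simp
  qed (use True in auto)
  show ?thesis
  proof (rule eigen_components_in_invariant_subspace[where M = K2 and I = "{..N - D}"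
        and p = "\<lambda>j. EP_star i j *v f"
        and \<theta> = "\<lambda>j. complex_of_real (real q powr (real (N - D) / 2 - real j))",
        OF s(1) H_module_gen(6)[OF U] _ inj_q_powr K2_EP_star row])
  qed (use True in auto)
next
  case False
  then have "EP_star i j *v f = 0"
    using P_partD by (auto simp: vec_eq_iff EP_star_nth)
  then show ?thesis using U vec.subspace_0 unfolding H_module_def is_module_def by auto
qed

lemma tilde_eq:
  assumes U: "H_module U"
  shows "tilde U = U \<inter> supported_vecs vertices"
proof
  have s: "vec.subspace U" using U unfolding H_module_def is_module_def by auto
  show "tilde U \<subseteq> U \<inter> supported_vecs vertices"
  proof
    fix f assume "f \<in> tilde U"
    then obtain p where f: "f = (\<Sum>j\<le>D. p j)" and p: "\<forall>j\<le>D. p j \<in> (*v) (EP_star (D - j) j) ` U"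
      unfolding tilde_def by blast
    have "p j \<in> U \<inter> supported_vecs vertices" if j: "j \<le> D" for j
    proof -
      obtain u where u: "u \<in> U" "p j = EP_star (D - j) j *v u" using p j by blast
      moreover have "P_part (D - j) j \<subseteq> vertices" using j unfolding P_part_iff vertices_def by (auto simp: P_part_iff)
      ultimately show ?thesis
        using H_module_EP_star[OF U] unfolding supported_vecs_def by (auto simp: EP_star_nth)
    qed
    then show "f \<in> U \<inter> supported_vecs vertices"
      unfolding f using vec.subspace_inter[OF s subspace_supported_vecs] by (intro vec.subspace_sum) auto
  qed
  show "U \<inter> supported_vecs vertices \<subseteq> tilde U"
  proof
    fix f assume f: "f \<in> U \<inter> supported_vecs vertices"
    then have "f = (\<Sum>j\<le>D. EP_star (D - j) j *v f)" by (intro sum_EP_star_vertices) blast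
    then show "f \<in> tilde U"
      unfolding tilde_def using f by (intro CollectI exI[of _ "\<lambda>j. EP_star (D - j) j *v f"]) auto
  qed
qed

lemma EP_adjacency_lift_down:
  assumes "Suc i \<le> D"
  shows "EP_star i (D - i) *v (adjacency_matrix *v lift (Suc i) (D - Suc i) g)
    = complex_of_real (bracket (D - i)) *s lift i (D - i) (down x *v g)"
proof -
  let ?f = "lift (Suc i) (D - Suc i) g"
  have f: "?f \<in> supported_vecs vertices"
    using assms unfolding supported_vecs_def vertices_def by (auto simp: lift_nth P_part_iff)
  have ne: "D - i = Suc (D - Suc i)" using assms by simp
  have E0: "EP_star i (D - i) *v (R1 *v lift i' j' g') = 0" if "i \<noteq> Suc i' \<or> D - i \<noteq> j'" for i' j' g'
    using that unfolding R1_lift matrix_vector_mult_smult EP_star_lift by auto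
  have E1: "EP_star i (D - i) *v (R1 *v (L1 *v ?f)) = 0"
    unfolding L1_lift by (rule E0) simp
  have E2: "EP_star i (D - i) *v (R1 *v (L2 *v ?f)) = 0" "EP_star i (D - i) *v (R2 *v (L2 *v ?f)) = 0"
    by (cases "D - Suc i"; simp add: L2_lift_0 L2_lift matrix_vector_mult_smult R1_lift R2_lift EP_star_lift
        del: of_real_diff)+
  have E3: "EP_star i (D - i) *v (R2 *v (L1 *v ?f))
      = complex_of_real (bracket (D - i)) *s lift i (D - i) (down x *v g)"
    unfolding L1_lift R2_lift matrix_vector_mult_smult EP_star_lift using ne by simp
  have E4: "EP_star i (D - i) *v ?f = 0" unfolding EP_star_lift by simp
  show ?thesis
    unfolding adjacency_eq_RL[OF f] matrix_vector_right_distrib matrix_vector_mult_diff_distrib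
      matrix_vector_mult_smult E1 E2 E3 E4 by simp
qed

lemma EP_adjacency_lift_up:
  assumes "Suc i \<le> D"
  shows "EP_star (Suc i) (D - Suc i) *v (adjacency_matrix *v lift i (D - i) g)
    = complex_of_real ((bracket (N - D + 1) - bracket (D - i)) * real q ^ (D - Suc i))
      *s lift (Suc i) (D - Suc i) (up x *v g)"
proof -
  let ?f = "lift i (D - i) g"
  have f: "?f \<in> supported_vecs vertices"
    using assms unfolding supported_vecs_def vertices_def by (auto simp: lift_nth P_part_iff)
  have ne: "D - i = Suc (D - Suc i)" using assms by simp
  have N: "N - (i + (D - Suc i)) = N - D + 1" using assms N_gt by simp
  have L2: "L2 *v ?f = complex_of_real (bracket (N - D + 1) - bracket (D - i)) *s lift i (D - Suc i) g"
    using L2_lift[of i "D - Suc i" g] unfolding N ne[symmetric] .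
  have E1: "EP_star (Suc i) (D - Suc i) *v (R1 *v (L1 *v ?f)) = 0"
    "EP_star (Suc i) (D - Suc i) *v (R2 *v (L1 *v ?f)) = 0"
    using ne by (cases i; simp add: L1_lift_0 L1_lift matrix_vector_mult_smult R1_lift R2_lift EP_star_lift)+
  have E2: "EP_star (Suc i) (D - Suc i) *v (R2 *v (L2 *v ?f)) = 0"
    unfolding L2 matrix_vector_mult_smult R2_lift EP_star_lift by simp
  have E3: "EP_star (Suc i) (D - Suc i) *v (R1 *v (L2 *v ?f))
      = complex_of_real ((bracket (N - D + 1) - bracket (D - i)) * real q ^ (D - Suc i))
      *s lift (Suc i) (D - Suc i) (up x *v g)"
    unfolding L2 matrix_vector_mult_smult R1_lift EP_star_lift vec.scale_scale of_real_mult by simp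
  have E4: "EP_star (Suc i) (D - Suc i) *v ?f = 0" unfolding EP_star_lift by simp
  show ?thesis
    unfolding adjacency_eq_RL[OF f] matrix_vector_right_distrib matrix_vector_mult_diff_distrib
      matrix_vector_mult_smult E1 E2 E3 E4 by simp
qed

end

locale grassmann_string = grassmann +
  fixes \<alpha> :: nat and g :: "complex ^ 'b set"
  assumes g_level_vecs: "g \<in> level_vecs x \<alpha>" and g_ne_0: "g \<noteq> 0" and down_g: "down x *v g = 0"
begin

lemma alpha_le_D: "\<alpha> \<le> D"
proof -
  obtain u where "g $ u \<noteq> 0" using g_ne_0 by (auto simp: vec_eq_iff)
  then have "u \<subseteq> x" "dim u = \<alpha>" using level_vecsD[OF g_level_vecs] by auto
  then show ?thesis using dim_mono dim_x by blast
qed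

lemma two_alpha_le_D: "2 * \<alpha> \<le> D"
proof (rule ccontr)
  assume "\<not> ?thesis"
  then have lt: "bracket (D - \<alpha>) - bracket \<alpha> < 0"
    using alpha_le_D bracket_strict_mono[of "D - \<alpha>" \<alpha>] by simp
  let ?n = "\<lambda>v :: complex ^ 'b set. \<Sum>i\<in>UNIV. (cmod (v $ i))\<^sup>2"
  have "hermitian_prod (up x *v g) (up x *v g)
      = hermitian_prod g (complex_of_real (bracket (D - \<alpha>) - bracket \<alpha>) *s g)"
    unfolding hermitian_prod_up down_up[OF subspace_x g_level_vecs] down_g dim_x by simp
  then have "complex_of_real (?n (up x *v g)) = complex_of_real ((bracket (D - \<alpha>) - bracket \<alpha>) * ?n g)"
    unfolding hermitian_prod_simps hermitian_prod_self complex_cnj_complex_of_real of_real_mult .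
  then have "?n (up x *v g) = (bracket (D - \<alpha>) - bracket \<alpha>) * ?n g" by (simp only: of_real_eq_iff)
  moreover have "0 \<le> ?n (up x *v g)" "0 \<le> ?n g" by (simp_all add: sum_nonneg)
  moreover have "?n g \<noteq> 0" using g_ne_0 hermitian_prod_self_eq_0[of g]
    unfolding hermitian_prod_self of_real_eq_0_iff by simp
  ultimately show False using lt mult_neg_pos[of "bracket (D - \<alpha>) - bracket \<alpha>" "?n g"] by linarith
qed

lemma alpha_bounds: "\<alpha> \<le> D - \<alpha>" "\<alpha> \<le> N - D" "D - \<alpha> \<le> N - D"
  using two_alpha_le_D N_gt by arith+

definition gs :: "nat \<Rightarrow> complex ^ 'b set" where
  "gs m = upn x m g"

lemma gs_level_vecs: "gs m \<in> level_vecs x (\<alpha> + m)"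
  unfolding gs_def by (rule upn_level_vecs[OF g_level_vecs])

lemma gs_ne_0: "2 * \<alpha> + m \<le> D \<Longrightarrow> gs m \<noteq> 0"
  unfolding gs_def using upn_inj[OF subspace_x g_level_vecs, of m] g_ne_0 dim_x by auto

lemma up_gs: "up x *v gs m = gs (Suc m)"
  unfolding gs_def by simp

lemma down_gs:
  assumes "\<alpha> + m \<le> D"
  shows "down x *v gs (Suc m) = complex_of_real (weight D (\<alpha> + Suc m) - weight D \<alpha>) *s gs m"
  unfolding gs_def using down_upn_kernel[OF subspace_x g_level_vecs down_g] assms dim_x by simp

lemma gs_eq_0:
  assumes "D < 2 * \<alpha> + m"
  shows "gs m = 0"
proof -
  let ?m = "D - 2 * \<alpha>"
  have "weight D (\<alpha> + Suc ?m) = weight D \<alpha>"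
  proof -
    have "\<alpha> + Suc ?m = D + 1 - \<alpha>" "D + 1 - (D + 1 - \<alpha>) = \<alpha>" using two_alpha_le_D by auto
    then have "weight D (\<alpha> + Suc ?m) = bracket (D + 1 - \<alpha>) * bracket \<alpha>" unfolding weight_def by (simp only:)
    then show ?thesis unfolding weight_def by (simp only: mult.commute)
  qed
  then have "down x *v gs (Suc ?m) = 0" using down_gs[of ?m] two_alpha_le_D by simp
  then have "hermitian_prod (gs ?m) (down x *v gs (Suc ?m)) = 0" by (simp add: hermitian_prod_def)
  then have "hermitian_prod (gs (Suc ?m)) (gs (Suc ?m)) = 0"
    by (simp only: hermitian_prod_up[symmetric] up_gs)
  then have z: "gs (Suc ?m) = 0" by (simp add: hermitian_prod_self_eq_0)
  have "gs (Suc ?m + k) = 0" for k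
  proof (induction k)
    case (Suc k)
    then show ?case using up_gs[of "Suc ?m + k"] by simp
  qed (use z in simp)
  from this[of "m - Suc ?m"] show ?thesis using assms two_alpha_le_D by simp
qed

definition bvec :: "nat \<Rightarrow> nat \<Rightarrow> complex ^ 'b set" where
  "bvec m j = lift (\<alpha> + m) j (gs m)"

lemma bvec_ne_0: "2 * \<alpha> + m \<le> D \<Longrightarrow> j \<le> N - D \<Longrightarrow> bvec m j \<noteq> 0"
  unfolding bvec_def using lift_eq_0D[OF gs_level_vecs] gs_ne_0 by blast

lemma bvec_eq_0: "\<not> (2 * \<alpha> + m \<le> D \<and> j \<le> N - D) \<Longrightarrow> bvec m j = 0"
  unfolding bvec_def using gs_eq_0[of m] lift_outside[of "\<alpha> + m" j] by fastforce

lemma L1_bvec_0: "L1 *v bvec 0 j = 0"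
proof (cases \<alpha>)
  case 0
  then show ?thesis unfolding bvec_def by (simp add: L1_lift_0)
next
  case (Suc a)
  then show ?thesis unfolding bvec_def using L1_lift[of a j g] down_g by (simp add: gs_def)
qed

lemma L1_bvec: "L1 *v bvec (Suc m) j = complex_of_real (weight D (\<alpha> + Suc m) - weight D \<alpha>) *s bvec m j"
proof (cases "\<alpha> + m \<le> D")
  case True
  show ?thesis
    unfolding bvec_def add_Suc_right L1_lift down_gs[OF True, unfolded add_Suc_right] lift_smult ..
next
  case False
  then show ?thesis using bvec_eq_0[of m j] bvec_eq_0[of "Suc m" j] two_alpha_le_D by simp
qed

lemma L2_bvec_0: "L2 *v bvec m 0 = 0"
  unfolding bvec_def by (rule L2_lift_0)

lemma L2_bvec: "L2 *v bvec m (Suc j)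
    = complex_of_real (bracket (N - (\<alpha> + m + j)) - bracket (D - (\<alpha> + m))) *s bvec m j"
  unfolding bvec_def by (rule L2_lift)

lemma R1_bvec: "R1 *v bvec m j = complex_of_real (real q ^ j) *s bvec (Suc m) j"
  unfolding bvec_def R1_lift up_gs by simp

lemma R2_bvec: "R2 *v bvec m j = complex_of_real (bracket (Suc j)) *s bvec m (Suc j)"
  unfolding bvec_def by (rule R2_lift)

lemma diag_bvec:
  assumes "\<And>w. w \<in> P_part (\<alpha> + m) j \<Longrightarrow> f w = a"
  shows "diag_on P f *v bvec m j = a *s bvec m j"
  unfolding bvec_def using assms
  by (auto simp: vec_eq_iff diag_on_nth lift_nth P_def P_part_iff)

definition \<Omega> :: "(complex ^ 'b set) set" where
  "\<Omega> = vec.span {bvec m j | m j. True}"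

lemma subspace_Omega: "vec.subspace \<Omega>"
  unfolding \<Omega>_def by (rule vec.subspace_span)

lemma bvec_Omega: "bvec m j \<in> \<Omega>"
  unfolding \<Omega>_def by (intro vec.span_base) blast

lemma smult_bvec_Omega: "c *s bvec m j \<in> \<Omega>"
  by (rule vec.subspace_scale[OF subspace_Omega bvec_Omega])

lemma Omega_closed: "(\<And>m j. M *v bvec m j \<in> \<Omega>) \<Longrightarrow> f \<in> \<Omega> \<Longrightarrow> M *v f \<in> \<Omega>"
  by (rule span_closed_matrix[OF subspace_Omega, of "{bvec m j | m j. True}"]) (auto simp: \<Omega>_def)

lemma diag_Omega:
  assumes "\<And>i j w. w \<in> P_part i j \<Longrightarrow> f w = a i j" "v \<in> \<Omega>"
  shows "diag_on P f *v v \<in> \<Omega>"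
proof (rule Omega_closed[OF _ assms(2)])
  fix m j
  show "diag_on P f *v bvec m j \<in> \<Omega>"
    using diag_bvec[of m j f "a (\<alpha> + m) j"] assms(1) smult_bvec_Omega by simp
qed

lemma Omega_supported: "\<Omega> \<subseteq> supported_vecs P"
  unfolding \<Omega>_def
proof (rule vec.span_minimal[OF _ subspace_supported_vecs])
  show "{bvec m j | m j. True} \<subseteq> supported_vecs P"
    unfolding supported_vecs_def P_def bvec_def by (auto simp: lift_nth P_part_iff)
qed

lemma Omega_gen:
  assumes "f \<in> \<Omega>"
  shows "L1 *v f \<in> \<Omega>" "L2 *v f \<in> \<Omega>" "R1 *v f \<in> \<Omega>" "R2 *v f \<in> \<Omega>"
    "K1 *v f \<in> \<Omega>" "K1_inv *v f \<in> \<Omega>" "K2 *v f \<in> \<Omega>" "K2_inv *v f \<in> \<Omega>"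
proof -
  have "L1 *v bvec m j \<in> \<Omega>" for m j
    by (cases m) (simp_all only: L1_bvec_0 L1_bvec smult_bvec_Omega vec.subspace_0[OF subspace_Omega])
  then show "L1 *v f \<in> \<Omega>" using Omega_closed assms by blast
  have "L2 *v bvec m j \<in> \<Omega>" for m j
    by (cases j) (simp_all only: L2_bvec_0 L2_bvec smult_bvec_Omega vec.subspace_0[OF subspace_Omega])
  then show "L2 *v f \<in> \<Omega>" using Omega_closed assms by blast
  have "R1 *v bvec m j \<in> \<Omega>" for m j by (simp only: R1_bvec smult_bvec_Omega)
  then show "R1 *v f \<in> \<Omega>" using Omega_closed assms by blast
  have "R2 *v bvec m j \<in> \<Omega>" for m j by (simp only: R2_bvec smult_bvec_Omega)
  then show "R2 *v f \<in> \<Omega>" using Omega_closed assms by blast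
  let ?k1 = "\<lambda>i j :: nat. complex_of_real (real q powr (real D / 2 - real i))"
  let ?k2 = "\<lambda>i j :: nat. complex_of_real (real q powr (real (N - D) / 2 - real j))"
  have k: "K1_entry w = ?k1 i j" "K2_entry w = ?k2 i j" if "w \<in> P_part i j" for w i j
    using that unfolding P_part_iff by (auto simp: K1_entry_def K2_entry_def)
  show "K1 *v f \<in> \<Omega>" unfolding K1_def by (rule diag_Omega[of _ ?k1, OF k(1) assms])
  show "K2 *v f \<in> \<Omega>" unfolding K2_def by (rule diag_Omega[of _ ?k2, OF k(2) assms])
  show "K1_inv *v f \<in> \<Omega>" unfolding K1_inv_def
    by (rule diag_Omega[of _ "\<lambda>i j. inverse (?k1 i j)", OF _ assms]) (simp add: k(1))
  show "K2_inv *v f \<in> \<Omega>" unfolding K2_inv_def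
    by (rule diag_Omega[of _ "\<lambda>i j. inverse (?k2 i j)", OF _ assms]) (simp add: k(2))
qed

lemma H_module_Omega: "H_module \<Omega>"
  unfolding H_module_def H_algebra_def
proof (rule is_module_gen_subalgebraI[OF subspace_Omega Omega_supported])
  fix M f assume "M \<in> {L1, L2, R1, R2, K1, K1_inv, K2, K2_inv}" "f \<in> \<Omega>"
  then show "M *v f \<in> \<Omega>" using Omega_gen[of f] by auto
qed

definition bvec_at :: "nat \<Rightarrow> nat \<Rightarrow> complex ^ 'b set" where
  "bvec_at i j = (if \<alpha> \<le> i then bvec (i - \<alpha>) j else 0)"

lemma EP_star_bvec: "EP_star i j *v bvec m j' = (if i = \<alpha> + m \<and> j = j' then bvec_at i j else 0)"
  unfolding bvec_def EP_star_lift bvec_at_def by auto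

lemma EP_star_Omega:
  assumes "f \<in> \<Omega>"
  shows "\<exists>c. EP_star i j *v f = c *s bvec_at i j"
proof -
  have "EP_star i j *v f \<in> vec.span {bvec_at i j}"
  proof (rule span_closed_matrix[OF vec.subspace_span _ assms[unfolded \<Omega>_def]])
    fix b assume "b \<in> {bvec m j | m j. True}"
    then show "EP_star i j *v b \<in> vec.span {bvec_at i j}"
      using vec.span_base[OF singletonI[of "bvec_at i j"]] vec.span_zero[of "{bvec_at i j}"]
      by (auto simp only: EP_star_bvec split: if_split)
  qed
  then show ?thesis unfolding vec.span_singleton by blast
qed

lemma EP_star_image_Omega: "(*v) (EP_star i j) ` \<Omega> = vec.span {bvec_at i j}"
proof
  show "(*v) (EP_star i j) ` \<Omega> \<subseteq> vec.span {bvec_at i j}"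
    using EP_star_Omega unfolding vec.span_singleton by blast
  show "vec.span {bvec_at i j} \<subseteq> (*v) (EP_star i j) ` \<Omega>"
  proof
    fix f assume "f \<in> vec.span {bvec_at i j}"
    then obtain c where f: "f = c *s bvec_at i j" unfolding vec.span_singleton by blast
    have "bvec_at i j \<in> \<Omega>" unfolding bvec_at_def using bvec_Omega vec.subspace_0[OF subspace_Omega] by simp
    then have "c *s bvec_at i j \<in> \<Omega>" by (rule vec.subspace_scale[OF subspace_Omega])
    moreover have "EP_star i j *v (c *s bvec_at i j) = c *s bvec_at i j"
      unfolding matrix_vector_mult_smult by (simp add: bvec_at_def EP_star_bvec)
    ultimately show "f \<in> (*v) (EP_star i j) ` \<Omega>" unfolding f by (metis image_eqI)
  qed
qed

lemma bvec_at_ne_0_iff: "bvec_at i j \<noteq> 0 \<longleftrightarrow> \<alpha> \<le> i \<and> i \<le> D - \<alpha> \<and> j \<le> N - D"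
proof (cases "\<alpha> \<le> i")
  case True
  then have "2 * \<alpha> + (i - \<alpha>) \<le> D \<longleftrightarrow> i \<le> D - \<alpha>" using two_alpha_le_D by arith
  then show ?thesis
    using True bvec_ne_0[of "i - \<alpha>" j] bvec_eq_0[of "i - \<alpha>" j] unfolding bvec_at_def by auto
qed (simp add: bvec_at_def)

lemma irreducible_Omega: "irreducible_H_module \<Omega>"
  unfolding irreducible_H_module_def is_irreducible_module_def
proof (intro conjI allI impI)
  show "is_module P H_algebra \<Omega>" using H_module_Omega unfolding H_module_def .
  show "\<Omega> \<noteq> {0}" using bvec_Omega[of 0 0] bvec_ne_0[of 0 0] two_alpha_le_D by auto
  fix U assume U: "is_module P H_algebra U \<and> U \<subseteq> \<Omega>"
  then have HU: "H_module U" and sub: "U \<subseteq> \<Omega>" unfolding H_module_def by auto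
  have s: "vec.subspace U" using U unfolding is_module_def by blast
  have cancel: "v \<in> U" if "c *s v \<in> U" "c \<noteq> 0" for c v
  proof -
    have "v = inverse c *s (c *s v)" using that(2) by simp
    then show ?thesis using vec.subspace_scale[OF s that(1)] by metis
  qed
  show "U = {0} \<or> U = \<Omega>"
  proof (rule disjCI)
    assume "U \<noteq> \<Omega>"
    show "U = {0}"
    proof (rule ccontr)
      assume "U \<noteq> {0}"
      then obtain f where f: "f \<in> U" "f \<noteq> 0" using vec.subspace_0[OF s] by blast
      have "f \<in> supported_vecs P" using f(1) sub Omega_supported by blast
      have "\<exists>i j. EP_star i j *v f \<noteq> 0"
      proof (rule ccontr)
        assume "\<not> ?thesis"
        then have "(\<Sum>(i, j)\<in>{..D} \<times> {..N - D}. EP_star i j *v f) = 0"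
          by (simp add: case_prod_beta)
        then show False using sum_EP_star[OF \<open>f \<in> supported_vecs P\<close>] f(2) by simp
      qed
      then obtain i j where ij: "EP_star i j *v f \<noteq> 0" by blast
      obtain c where c: "EP_star i j *v f = c *s bvec_at i j" using EP_star_Omega f(1) sub by blast
      have "c *s bvec_at i j \<in> U" using H_module_EP_star[OF HU f(1), of i j] unfolding c .
      moreover have "c \<noteq> 0" "bvec_at i j \<noteq> 0" using ij c by auto
      ultimately have "bvec_at i j \<in> U" and r: "\<alpha> \<le> i" "i \<le> D - \<alpha>" "j \<le> N - D"
        using cancel bvec_at_ne_0_iff by auto
      then have "bvec (i - \<alpha>) j \<in> U" "2 * \<alpha> + (i - \<alpha>) \<le> D" unfolding bvec_at_def using two_alpha_le_D by auto
      moreover have "bvec 0 j \<in> U" if "bvec m j \<in> U" "2 * \<alpha> + m \<le> D" for m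
        using that
      proof (induction m)
        case (Suc m)
        have "complex_of_real (weight D (\<alpha> + Suc m) - weight D \<alpha>) *s bvec m j \<in> U"
          using H_module_gen(1)[OF HU Suc.prems(1)] unfolding L1_bvec .
        moreover have "weight D \<alpha> < weight D (\<alpha> + Suc m)" using Suc.prems(2) by (intro weight_less) auto
        then have "complex_of_real (weight D (\<alpha> + Suc m) - weight D \<alpha>) \<noteq> 0" unfolding of_real_eq_0_iff by simp
        ultimately have "bvec m j \<in> U" by (rule cancel)
        then show ?case using Suc.IH Suc.prems(2) by simp
      qed
      ultimately have "bvec 0 j \<in> U" by blast
      then have b00: "bvec 0 0 \<in> U" using r(3)
      proof (induction j)
        case (Suc j)
        have "complex_of_real (bracket (N - (\<alpha> + 0 + j)) - bracket (D - (\<alpha> + 0))) *s bvec 0 j \<in> U"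
          using H_module_gen(2)[OF HU Suc.prems(1)] unfolding L2_bvec .
        moreover have "D - (\<alpha> + 0) < N - (\<alpha> + 0 + j)" using Suc.prems(2) alpha_le_D N_gt by linarith
        then have "bracket (D - (\<alpha> + 0)) < bracket (N - (\<alpha> + 0 + j))" by (rule bracket_strict_mono)
        then have "complex_of_real (bracket (N - (\<alpha> + 0 + j)) - bracket (D - (\<alpha> + 0))) \<noteq> 0"
          unfolding of_real_eq_0_iff by simp
        ultimately have "bvec 0 j \<in> U" by (rule cancel)
        then show ?case using Suc by simp
      qed
      have b0: "bvec m 0 \<in> U" for m
      proof (induction m)
        case (Suc m)
        have "complex_of_real (real q ^ 0) *s bvec (Suc m) 0 \<in> U"
          using H_module_gen(3)[OF HU Suc.IH] unfolding R1_bvec .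
        then show ?case by simp
      qed (rule b00)
      have "bvec m j \<in> U" for m j
      proof (induction j)
        case (Suc j)
        have "complex_of_real (bracket (Suc j)) *s bvec m (Suc j) \<in> U"
          using H_module_gen(4)[OF HU Suc.IH] unfolding R2_bvec .
        moreover have "0 < bracket (Suc j)" by (rule bracket_pos) simp
        then have "complex_of_real (bracket (Suc j)) \<noteq> 0" unfolding of_real_eq_0_iff by simp
        ultimately show ?case by (rule cancel)
      qed (rule b0)
      then have "\<Omega> \<subseteq> U" unfolding \<Omega>_def using s by (intro vec.span_minimal) auto
      then show False using sub \<open>U \<noteq> \<Omega>\<close> by blast
    qed
  qed
qed

lemma alpha_dominant_Omega: "alpha_dominant \<Omega> \<alpha>"
proof -
  have "vec.dim ((*v) (EP_star i j) ` \<Omega>) = (if \<alpha> \<le> i \<and> i \<le> D - \<alpha> then 1 else 0)"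
    if "j \<le> N - D" for i j
    unfolding EP_star_image_Omega vec.dim_span using bvec_at_ne_0_iff[of i j] that by auto
  then show ?thesis
    unfolding alpha_dominant_def has_type_def using irreducible_Omega two_alpha_le_D by simp
qed

lemma T_module_tilde_Omega: "is_module vertices T_algebra (tilde \<Omega>)"
  unfolding tilde_eq[OF H_module_Omega]
  by (rule T_module_Int_vertices[OF subspace_Omega]) (rule Omega_gen H_module_EP_star[OF H_module_Omega], assumption)+

lemma bvec_at_tilde:
  assumes "i \<le> D"
  shows "bvec_at i (D - i) \<in> tilde \<Omega>"
proof -
  have "bvec_at i (D - i) \<in> \<Omega>" unfolding bvec_at_def using bvec_Omega vec.subspace_0[OF subspace_Omega] by simp
  moreover have "bvec_at i (D - i) \<in> supported_vecs vertices"
    using assms unfolding bvec_at_def bvec_def supported_vecs_def vertices_def by (auto simp: lift_nth P_part_iff)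
  ultimately show ?thesis unfolding tilde_eq[OF H_module_Omega] by blast
qed

lemma tilde_Omega_sum:
  assumes "f \<in> tilde \<Omega>"
  shows "\<exists>c. f = (\<Sum>i\<le>D. c i *s bvec_at (D - i) i)"
proof -
  have f: "f \<in> \<Omega>" "f \<in> supported_vecs vertices" using assms unfolding tilde_eq[OF H_module_Omega] by auto
  have "\<forall>i. \<exists>c. EP_star (D - i) i *v f = c *s bvec_at (D - i) i" using EP_star_Omega[OF f(1)] by blast
  then obtain c where "\<And>i. EP_star (D - i) i *v f = c i *s bvec_at (D - i) i" by metis
  then have "f = (\<Sum>i\<le>D. c i *s bvec_at (D - i) i)" using sum_EP_star_vertices[OF f(2)] by simp
  then show ?thesis by blast
qed

lemma tilde_Omega_subset:
  assumes W: "is_module vertices T_algebra W" and "lift \<alpha> (D - \<alpha>) g \<in> W"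
  shows "tilde \<Omega> \<subseteq> W"
proof -
  have s: "vec.subspace W" using W unfolding is_module_def by blast
  have b: "bvec m (D - (\<alpha> + m)) \<in> W" if "\<alpha> + m \<le> D" for m
    using that
  proof (induction m)
    case 0
    then show ?case using assms(2) by (simp add: bvec_def gs_def)
  next
    case (Suc m)
    let ?i = "\<alpha> + m"
    have i: "Suc ?i \<le> D" using Suc.prems by simp
    have "lift ?i (D - ?i) (gs m) \<in> W" using Suc unfolding bvec_def by simp
    then have "E_star (D - Suc ?i) *v (adjacency_matrix *v lift ?i (D - ?i) (gs m)) \<in> W"
      by (intro T_module_E_star[OF W] T_module_adjacency[OF W]) auto
    moreover have "E_star (D - Suc ?i) = EP_star (Suc ?i) (D - Suc ?i)"
      using E_star_eq[of "D - Suc ?i"] i by simp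
    ultimately have *: "complex_of_real ((bracket (N - D + 1) - bracket (D - ?i)) * real q ^ (D - Suc ?i))
        *s bvec (Suc m) (D - Suc ?i) \<in> W"
      using EP_adjacency_lift_up[OF i, of "gs m"] unfolding up_gs bvec_def by simp
    have "bracket (D - ?i) < bracket (N - D + 1)" using N_gt by (intro bracket_strict_mono) simp
    then have ne: "complex_of_real ((bracket (N - D + 1) - bracket (D - ?i)) * real q ^ (D - Suc ?i)) \<noteq> 0" (is "?c \<noteq> 0")
      unfolding of_real_eq_0_iff using q_ge_2 by simp
    have "bvec (Suc m) (D - Suc ?i) = inverse ?c *s (?c *s bvec (Suc m) (D - Suc ?i))"
      unfolding vec.scale_scale using left_inverse[OF ne] by (simp only: vec.scale_one)
    then have "bvec (Suc m) (D - Suc ?i) \<in> W" using vec.subspace_scale[OF s *] by metis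
    then show ?case by simp
  qed
  have bvec_at: "bvec_at (D - i) i \<in> W" if "i \<le> D" for i
    using b[of "D - i - \<alpha>"] that vec.subspace_0[OF s] unfolding bvec_at_def by auto
  show ?thesis
  proof
    fix f assume "f \<in> tilde \<Omega>"
    then obtain c where "f = (\<Sum>i\<le>D. c i *s bvec_at (D - i) i)" using tilde_Omega_sum by blast
    then show "f \<in> W" using bvec_at by (auto intro!: vec.subspace_sum[OF s] vec.subspace_scale[OF s])
  qed
qed

lemma endpoint_tilde_Omega: "endpoint (tilde \<Omega>) = \<alpha>"
proof -
  have s: "vec.subspace (tilde \<Omega>)" using T_module_tilde_Omega unfolding is_module_def by blast
  show ?thesis
    unfolding endpoint_def
  proof (rule Least_equality)
    have "bvec_at (D - \<alpha>) \<alpha> \<in> tilde \<Omega>" using bvec_at_tilde[of "D - \<alpha>"] alpha_le_D by simp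
    moreover have "E_star \<alpha> *v bvec_at (D - \<alpha>) \<alpha> = bvec_at (D - \<alpha>) \<alpha>"
      unfolding E_star_eq[OF alpha_le_D] by (simp add: bvec_at_def EP_star_bvec)
    moreover have "bvec_at (D - \<alpha>) \<alpha> \<noteq> 0" using bvec_at_ne_0_iff[of "D - \<alpha>" \<alpha>] alpha_bounds by simp
    ultimately show "\<alpha> \<le> D \<and> (*v) (E_star \<alpha>) ` tilde \<Omega> \<noteq> {0}"
      using image_ne_0_iff[OF s] alpha_le_D by metis
    fix i assume i: "i \<le> D \<and> (*v) (E_star i) ` tilde \<Omega> \<noteq> {0}"
    then obtain f where f: "f \<in> tilde \<Omega>" "E_star i *v f \<noteq> 0" using image_ne_0_iff[OF s] by blast
    then have "f \<in> \<Omega>" unfolding tilde_eq[OF H_module_Omega] by blast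
    then obtain c where "EP_star (D - i) i *v f = c *s bvec_at (D - i) i" using EP_star_Omega by blast
    then have "bvec_at (D - i) i \<noteq> 0" using f(2) E_star_eq[of i] i by auto
    then show "\<alpha> \<le> i" using bvec_at_ne_0_iff[of "D - i" i] i alpha_le_D by linarith
  qed
qed

lemma H_closure_tilde_Omega: "H_closure (tilde \<Omega>) = \<Omega>"
  unfolding H_closure_def
proof
  show "\<Inter> {\<Omega>'. H_module \<Omega>' \<and> tilde \<Omega>' = tilde \<Omega>} \<subseteq> \<Omega>" using H_module_Omega by blast
  have "bvec_at \<alpha> (D - \<alpha>) \<in> tilde \<Omega>" using bvec_at_tilde alpha_le_D by blast
  moreover have "bvec_at \<alpha> (D - \<alpha>) \<noteq> 0" using bvec_at_ne_0_iff[of \<alpha> "D - \<alpha>"] alpha_bounds by simp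
  ultimately have "\<Omega> \<subseteq> \<Omega>'" if "H_module \<Omega>'" "tilde \<Omega>' = tilde \<Omega>" for \<Omega>'
    using irreducible_subset[of P H_algebra \<Omega> \<Omega>' "bvec_at \<alpha> (D - \<alpha>)"] irreducible_Omega that
      tilde_eq[OF H_module_Omega] tilde_eq[OF that(1)]
    unfolding irreducible_H_module_def H_module_def by blast
  then show "\<Omega> \<subseteq> \<Inter> {\<Omega>'. H_module \<Omega>' \<and> tilde \<Omega>' = tilde \<Omega>}" by blast
qed

end

context grassmann
begin

lemma irreducible_in_trace_functions_string:
  assumes irr: "irreducible_T_module W" and "W \<subseteq> trace_functions"
  shows "\<exists>\<alpha> g. grassmann_string scale q N D x \<alpha> g \<and> lift \<alpha> (D - \<alpha>) g \<in> W"
proof -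
  have mod: "is_module vertices T_algebra W" and ne: "W \<noteq> {0}"
    using irr unfolding irreducible_T_module_def is_irreducible_module_def by auto
  have W: "vec.subspace W" "W \<subseteq> supported_vecs vertices"
    using mod unfolding is_module_def by auto
  have EW: "EP_star a (D - a) *v w \<in> W" if "a \<le> D" "w \<in> W" for a w
    using T_module_E_star[OF mod _ that(2), of "D - a"] E_star_eq[of "D - a"] that(1) by simp
  define Q where "Q a \<longleftrightarrow> a \<le> D \<and> (\<exists>w\<in>W. EP_star a (D - a) *v w \<noteq> 0)" for a
  obtain w where w: "w \<in> W" "w \<noteq> 0" using ne vec.subspace_0[OF W(1)] by blast
  then obtain i where "i \<le> D" "E_star i *v w \<noteq> 0" using E_star_ne_0[of w] W(2) by blast
  then have "Q (D - i)" unfolding Q_def using w(1) E_star_eq[of i] by auto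
  then have ex: "\<exists>a. Q a" by blast
  define \<alpha> where "\<alpha> = (LEAST a. Q a)"
  have "Q \<alpha>" unfolding \<alpha>_def using ex by (rule LeastI_ex)
  then obtain v where \<alpha>: "\<alpha> \<le> D" and v: "v \<in> W" "EP_star \<alpha> (D - \<alpha>) *v v \<noteq> 0" unfolding Q_def by blast
  obtain g where g: "g \<in> level_vecs x \<alpha>" "EP_star \<alpha> (D - \<alpha>) *v v = lift \<alpha> (D - \<alpha>) g"
    using EP_star_trace_functions[of v \<alpha> "D - \<alpha>"] v(1) assms(2) by blast
  have lW: "lift \<alpha> (D - \<alpha>) g \<in> W" using EW[OF \<alpha> v(1)] g(2) by simp
  have "g \<noteq> 0" using v(2) g(2) by auto
  moreover have "down x *v g = 0"
  proof (cases \<alpha>)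
    case 0
    then show ?thesis using g(1) down_level_vecs_0 by blast
  next
    case (Suc a)
    have "\<not> Q a" using not_less_Least[of a Q] Suc unfolding \<alpha>_def by simp
    moreover have "adjacency_matrix *v lift \<alpha> (D - \<alpha>) g \<in> W" by (rule T_module_adjacency[OF mod lW])
    ultimately have "EP_star a (D - a) *v (adjacency_matrix *v lift (Suc a) (D - Suc a) g) = 0"
      using \<alpha> Suc unfolding Q_def by auto
    then have "complex_of_real (bracket (D - a)) *s lift a (D - a) (down x *v g) = 0"
      using EP_adjacency_lift_down[of a g] \<alpha> Suc by simp
    moreover have "0 < bracket (D - a)" using \<alpha> Suc by (intro bracket_pos) simp
    ultimately have "lift a (D - a) (down x *v g) = 0" by simp
    moreover have "down x *v g \<in> level_vecs x a" using g(1) Suc down_level_vecs by blast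
    ultimately show ?thesis using lift_eq_0D[of "down x *v g" a "D - a"] N_gt by simp
  qed
  ultimately have "grassmann_string scale q N D x \<alpha> g" using g(1) by unfold_locales
  then show ?thesis using lW by blast
qed

lemma irreducible_nucleus_H_closure:
  assumes irr: "irreducible_T_module W" and "W \<subseteq> nucleus" and "endpoint W = r"
  shows "irreducible_H_module (H_closure W) \<and> alpha_dominant (H_closure W) r"
proof -
  have "W \<subseteq> trace_functions" using assms(2) nucleus_subset_trace_functions by blast
  then obtain \<alpha> g where string: "grassmann_string scale q N D x \<alpha> g" and lW: "lift \<alpha> (D - \<alpha>) g \<in> W"
    using irreducible_in_trace_functions_string[OF irr] by blast
  interpret S: grassmann_string scale q N D x \<alpha> g by (fact string)
  have irr': "is_irreducible_module vertices T_algebra W"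
    using irr unfolding irreducible_T_module_def .
  then have "tilde S.\<Omega> \<subseteq> W"
    using S.tilde_Omega_subset lW unfolding is_irreducible_module_def by blast
  moreover have "S.bvec_at \<alpha> (D - \<alpha>) \<in> tilde S.\<Omega>" using S.bvec_at_tilde S.alpha_le_D by blast
  moreover have "S.bvec_at \<alpha> (D - \<alpha>) \<noteq> 0" using S.bvec_at_ne_0_iff[of \<alpha> "D - \<alpha>"] S.alpha_bounds by simp
  ultimately have W: "W = tilde S.\<Omega>"
    using irreducible_subset[OF irr' S.T_module_tilde_Omega] by blast
  have r: "r = \<alpha>" using assms(3) S.endpoint_tilde_Omega unfolding W by simp
  show ?thesis
    unfolding W S.H_closure_tilde_Omega r using S.irreducible_Omega S.alpha_dominant_Omega by blast
qed

end

theorem lemma6p7: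
  fixes scale :: "'a::{field,finite} \<Rightarrow> 'v::{ab_group_add,finite} \<Rightarrow> 'v"
    and q N D r :: nat
    and x :: "'v set"
    and W :: "(complex ^ 'v set) set"
  assumes "grassmann scale q N D x"
    and "grassmann.irreducible_T_module scale D x W"
    and "W \<subseteq> grassmann.nucleus scale q N D x"
    and "grassmann.endpoint scale D x W = r"
  shows "grassmann.irreducible_H_module scale q N D x (grassmann.H_closure scale q N D x W) \<and>
    grassmann.alpha_dominant scale q N D x (grassmann.H_closure scale q N D x W) r"
  using grassmann.irreducible_nucleus_H_closure[OF assms] .

end
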